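(* Let $P\in\mathsf{RSP}_n$ be a regular Schur labeled skew shape poset and let $C$ be the equivalence class of $\Sigma_L(P)$ in $\mathrm{Int}(n)$ under $\overset{D}{\simeq}$. Then $$C=\{\Sigma_L(Q)\mid Q\in\mathsf{RSP}_n\text{ with }\mathrm{sh}(\tau_Q)=\mathrm{sh}(\tau_P)\}.$$
   Context: $\mathfrak S_n$ is the symmetric group on $[n]=\{1,\dots,n\}$ with length function $\ell$ and simple transpositions $s_i=(i,i+1)$. For $\sigma\in\mathfrak S_n$, $\mathrm{Des}_L(\sigma)=\{i\in[n-1]\mid\ell(s_i\sigma)<\ell(\sigma)\}$. The left weak Bruhat order $\preceq_L$ is the partial order on $\mathfrak S_n$ with covering relations $\sigma\prec s_i\sigma$ whenever $\ell(s_i\sigma)>\ell(\sigma)$; $[\sigma,\rho]_L=\{\gamma\mid\sigma\preceq_L\gamma\preceq_L\rho\}$; $\mathrm{Int}(n)$ is the set of nonempty intervals $[\sigma,\rho]_L$. For $I_1,I_2\in\mathrm{Int}(n)$, write $I_1\overset{D}{\simeq}I_2$ if there is a poset isomorphism $f:(I_1,\preceq_L)\to(I_2,\preceq_L)$ with $\mathrm{Des}_L(\gamma)=\mathrm{Des}_L(f(\gamma))$ for all $\gamma\in I_1$; this is an equivalence relation. A skew partition $\lambda/\mu$ is a pair of partitions with $\mu_i\le\lambda_i$ for all $i$ (missing parts are $0$); its Young diagram is the set of boxes $(i,j)$ (row $i$ counted from the top, column $j$ from the left) with $\mu_i<j\le\lambda_i$; its size is $|\lambda|-|\mu|$. Every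 skew partition is assumed basic: its Young diagram has no empty rows and no empty columns. It is connected if for each pair of consecutive rows there are two boxes, one in each row, sharing an edge; in general the diagram splits into connected components, ordered from the top. A bijective tableau of shape $\lambda/\mu$ (of size $n$) is a filling of the Young diagram in which each element of $[n]$ appears exactly once; $\mathrm{sh}(\tau)$ is the shape of $\tau$. For a bijective tableau $\tau$, $\mathsf{poset}(\tau)$ is the poset on $[n]$ with $i\preceq_\tau j$ iff the box of $i$ is weakly above and weakly left of the box of $j$ in $\tau$. A Schur labeling is a bijective tableau whose rows decrease from left to right and whose columns increase from top to bottom. $\mathsf P_n$ is the set of posets with underlying set $[n]$. $\mathsf{SP}_n$ (Schur labeled skew shape posets) is the set of all $\mathsf{poset}(\tau)$ with $\tau$ a Schur labeling of some skew shape of size $n$. $P\in\mathsf P_n$ is regular if for all $x,y,z\in[n]$ with $x\preceq_P z$ and ($x<y<z$ or $z<y<x$), one has $x\preceq_P y$ or $y\preceq_P z$. $\mathsf{RSP}_n$ is the set of regular posets in $\mathsf{SP}_n$. For $P\in\mathsf{SP}_n$, $\tau_P$ is the unique Schur labeling $\tau$ of basic shape with $\mathsf{poset}(\tau)=P$ such that the minimum entry of the $i$th connected component of $\tau$ from the top is smaller than that of the $j$th component whenever $i<j$. $\Sigma_L(P)=\{\sigma\in\mathfrak S_n\mid \sigma(i)\le\sigma(j)\text{ for all } i\preceq_P j\}$. It is known (Björner–Wachs) that $\Sigma_L(P)\in\mathrm{Int}(n)$ when $P$ is regular. *)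

theory Defs
  imports "HOL-Combinatorics.Permutations" "HOL-Library.FuncSet"
begin

section \<open>Symmetric groups and the left weak Bruhat order\<close>

definition Sym :: "nat \<Rightarrow> (nat \<Rightarrow> nat) set" where
  "Sym n = {\<sigma>. \<sigma> permutes {1..n}}"

definition simple_transp :: "nat \<Rightarrow> nat \<Rightarrow> nat" where
  "simple_transp i = transpose i (i + 1)"

text \<open>The least number of factors in an expression of \<open>\<sigma>\<close> as a product of simple transpositions
  of \<open>{1..n}\<close>; meaningful only for \<open>\<sigma>\<close> in \<open>Sym n\<close>.\<close>
definition perm_length :: "nat \<Rightarrow> (nat \<Rightarrow> nat) \<Rightarrow> nat" where
  "perm_length n \<sigma> =
     (LEAST k. \<exists>w. length w = k \<and> set w \<subseteq> {1..<n} \<and> foldr (\<circ>) (map simple_transp w) id = \<sigma>)"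

definition Des_L :: "nat \<Rightarrow> (nat \<Rightarrow> nat) \<Rightarrow> nat set" where
  "Des_L n \<sigma> = {i \<in> {1..<n}. perm_length n (simple_transp i \<circ> \<sigma>) < perm_length n \<sigma>}"

definition weak_cover :: "nat \<Rightarrow> ((nat \<Rightarrow> nat) \<times> (nat \<Rightarrow> nat)) set" where
  "weak_cover n = {(\<sigma>, simple_transp i \<circ> \<sigma>) | \<sigma> i.
     \<sigma> \<in> Sym n \<and> i \<in> {1..<n} \<and> perm_length n (simple_transp i \<circ> \<sigma>) > perm_length n \<sigma>}"

text \<open>The restriction discards the reflexive pairs of functions outside \<open>Sym n\<close>.\<close>
definition weak_order :: "nat \<Rightarrow> ((nat \<Rightarrow> nat) \<times> (nat \<Rightarrow> nat)) set" where
  "weak_order n = (weak_cover n)\<^sup>* \<inter> Sym n \<times> Sym n"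

definition weak_interval :: "nat \<Rightarrow> (nat \<Rightarrow> nat) \<Rightarrow> (nat \<Rightarrow> nat) \<Rightarrow> (nat \<Rightarrow> nat) set" where
  "weak_interval n \<sigma> \<rho> = {\<gamma>. (\<sigma>, \<gamma>) \<in> weak_order n \<and> (\<gamma>, \<rho>) \<in> weak_order n}"

definition Int_L :: "nat \<Rightarrow> (nat \<Rightarrow> nat) set set" where
  "Int_L n = {weak_interval n \<sigma> \<rho> | \<sigma> \<rho>. \<sigma> \<in> Sym n \<and> \<rho> \<in> Sym n \<and> weak_interval n \<sigma> \<rho> \<noteq> {}}"

definition descent_equiv :: "nat \<Rightarrow> ((nat \<Rightarrow> nat) set \<times> (nat \<Rightarrow> nat) set) set" where
  "descent_equiv n = {(I, J). I \<in> Int_L n \<and> J \<in> Int_L n \<and>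
     (\<exists>f. bij_betw f I J \<and>
          (\<forall>\<gamma>\<in>I. \<forall>\<delta>\<in>I. (\<gamma>, \<delta>) \<in> weak_order n \<longleftrightarrow> (f \<gamma>, f \<delta>) \<in> weak_order n) \<and>
          (\<forall>\<gamma>\<in>I. Des_L n \<gamma> = Des_L n (f \<gamma>)))}"

section \<open>Skew partitions\<close>

text \<open>Partitions are weakly decreasing lists of positive integers; \<open>part p i\<close> is the part with
  1-based index \<open>i\<close>, and is 0 when that part is missing.\<close>

definition is_partition :: "nat list \<Rightarrow> bool" where
  "is_partition p \<longleftrightarrow> sorted_wrt (\<ge>) p \<and> 0 \<notin> set p"

definition part :: "nat list \<Rightarrow> nat \<Rightarrow> nat" where
  "part p i = (if 1 \<le> i \<and> i \<le> length p then p ! (i - 1) else 0)"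

type_synonym skew = "nat list \<times> nat list"
type_synonym box = "nat \<times> nat"

definition is_skew :: "skew \<Rightarrow> bool" where
  "is_skew S \<longleftrightarrow> is_partition (fst S) \<and> is_partition (snd S) \<and>
     (\<forall>i\<ge>1. part (snd S) i \<le> part (fst S) i)"

definition diagram :: "skew \<Rightarrow> box set" where
  "diagram S = {(i, j). 1 \<le> i \<and> part (snd S) i < j \<and> j \<le> part (fst S) i}"

text \<open>The rows and columns that must not be empty are those of the outer partition.\<close>
definition basic :: "skew \<Rightarrow> bool" where
  "basic S \<longleftrightarrow> is_skew S \<and>
     (\<forall>i\<in>{1..length (fst S)}. \<exists>j. (i, j) \<in> diagram S) \<and>
     (\<forall>j\<in>{1..part (fst S) 1}. \<exists>i. (i, j) \<in> diagram S)"

definition share_edge :: "box \<Rightarrow> box \<Rightarrow> bool" where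
  "share_edge a b \<longleftrightarrow>
     (fst a = fst b \<and> (snd b = snd a + 1 \<or> snd a = snd b + 1)) \<or>
     (snd a = snd b \<and> (fst b = fst a + 1 \<or> fst a = fst b + 1))"

definition components :: "box set \<Rightarrow> box set set" where
  "components D = D // {(a, b). a \<in> D \<and> b \<in> D \<and> share_edge a b}\<^sup>*"

section \<open>Schur labelings and their posets\<close>

text \<open>A tableau is a shape together with its filling.\<close>
type_synonym tableau = "skew \<times> (box \<Rightarrow> nat)"

definition sh :: "tableau \<Rightarrow> skew" where
  "sh \<tau> = fst \<tau>"

definition entry :: "tableau \<Rightarrow> box \<Rightarrow> nat" where
  "entry \<tau> = snd \<tau>"

text \<open>Extensionality makes equality of tableaux independent of values off the diagram, as needed for
  the definite description in \<open>tau\<close>. The bijection forces the shape to have size \<open>n\<close>.\<close>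
definition bijective_tableau :: "nat \<Rightarrow> tableau \<Rightarrow> bool" where
  "bijective_tableau n \<tau> \<longleftrightarrow> basic (sh \<tau>) \<and>
     bij_betw (entry \<tau>) (diagram (sh \<tau>)) {1..n} \<and> entry \<tau> \<in> extensional (diagram (sh \<tau>))"

text \<open>A poset is represented by the set of pairs \<open>(x, y)\<close> with \<open>x\<close> below or equal to \<open>y\<close>.\<close>
definition poset :: "tableau \<Rightarrow> (nat \<times> nat) set" where
  "poset \<tau> = {(entry \<tau> a, entry \<tau> b) | a b.
     a \<in> diagram (sh \<tau>) \<and> b \<in> diagram (sh \<tau>) \<and> fst a \<le> fst b \<and> snd a \<le> snd b}"

definition schur_labeling :: "nat \<Rightarrow> tableau \<Rightarrow> bool" where
  "schur_labeling n \<tau> \<longleftrightarrow> bijective_tableau n \<tau> \<and>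
     (\<forall>i j j'. (i, j) \<in> diagram (sh \<tau>) \<and> (i, j') \<in> diagram (sh \<tau>) \<and> j < j'
        \<longrightarrow> entry \<tau> (i, j) > entry \<tau> (i, j')) \<and>
     (\<forall>i i' j. (i, j) \<in> diagram (sh \<tau>) \<and> (i', j) \<in> diagram (sh \<tau>) \<and> i < i'
        \<longrightarrow> entry \<tau> (i, j) < entry \<tau> (i', j))"

definition Posets :: "nat \<Rightarrow> (nat \<times> nat) set set" where
  "Posets n = {P. partial_order_on {1..n} P}"

definition SP :: "nat \<Rightarrow> (nat \<times> nat) set set" where
  "SP n = {poset \<tau> | \<tau>. schur_labeling n \<tau>}"

lemma SP_subset_Posets: "SP n \<subseteq> Posets n"
proof
  fix P assume "P \<in> SP n"
  then obtain \<tau> where P: "P = poset \<tau>"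
    and b: "bij_betw (entry \<tau>) (diagram (sh \<tau>)) {1..n}"
    by (auto simp: SP_def schur_labeling_def bijective_tableau_def)
  have im: "entry \<tau> ` diagram (sh \<tau>) = {1..n}" and inj: "inj_on (entry \<tau>) (diagram (sh \<tau>))"
    using b by (auto simp: bij_betw_def)
  have sub: "P \<subseteq> {1..n} \<times> {1..n}"
    unfolding P poset_def using im by blast
  have "refl_on {1..n} P"
    unfolding refl_on_def P poset_def im[symmetric] by auto
  moreover have "trans P"
  proof (rule transI)
    fix x y z assume "(x, y) \<in> P" "(y, z) \<in> P"
    then obtain a b b' c where *: "x = entry \<tau> a" "y = entry \<tau> b" "y = entry \<tau> b'" "z = entry \<tau> c"
      "{a, b, b', c} \<subseteq> diagram (sh \<tau>)"
      "fst a \<le> fst b" "snd a \<le> snd b" "fst b' \<le> fst c" "snd b' \<le> snd c"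
      unfolding P poset_def by blast
    then have "b = b'" using inj by (auto dest: inj_onD)
    with * have "fst a \<le> fst c" "snd a \<le> snd c" by auto
    with * show "(x, z) \<in> P" unfolding P poset_def by blast
  qed
  moreover have "antisym P"
  proof (rule antisymI)
    fix x y assume "(x, y) \<in> P" "(y, x) \<in> P"
    then obtain a b a' b' where *: "x = entry \<tau> a" "y = entry \<tau> b" "y = entry \<tau> b'" "x = entry \<tau> a'"
      "{a, b, a', b'} \<subseteq> diagram (sh \<tau>)"
      "fst a \<le> fst b" "snd a \<le> snd b" "fst b' \<le> fst a'" "snd b' \<le> snd a'"
      unfolding P poset_def by blast
    then have "b = b'" "a = a'" using inj by (auto dest: inj_onD)
    with * have "a = b" by (auto intro: prod_eqI)
    with * show "x = y" by simp
  qed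
  ultimately show "P \<in> Posets n"
    using sub by (auto simp: Posets_def partial_order_on_def preorder_on_def)
qed

definition regular :: "nat \<Rightarrow> (nat \<times> nat) set \<Rightarrow> bool" where
  "regular n P \<longleftrightarrow> (\<forall>x\<in>{1..n}. \<forall>y\<in>{1..n}. \<forall>z\<in>{1..n}.
     (x, z) \<in> P \<and> (x < y \<and> y < z \<or> z < y \<and> y < x) \<longrightarrow> (x, y) \<in> P \<or> (y, z) \<in> P)"

definition RSP :: "nat \<Rightarrow> (nat \<times> nat) set set" where
  "RSP n = {P \<in> SP n. regular n P}"

text \<open>Distinct components of a skew diagram occupy disjoint sets of consecutive rows, so comparing
  their topmost rows orders them from the top.\<close>
definition components_ordered :: "tableau \<Rightarrow> bool" where
  "components_ordered \<tau> \<longleftrightarrow>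
     (\<forall>A\<in>components (diagram (sh \<tau>)). \<forall>B\<in>components (diagram (sh \<tau>)).
        Min (fst ` A) < Min (fst ` B) \<longrightarrow> Min (entry \<tau> ` A) < Min (entry \<tau> ` B))"

definition tau :: "nat \<Rightarrow> (nat \<times> nat) set \<Rightarrow> tableau" where
  "tau n P = (THE \<tau>. schur_labeling n \<tau> \<and> poset \<tau> = P \<and> components_ordered \<tau>)"

definition Sigma_L :: "nat \<Rightarrow> (nat \<times> nat) set \<Rightarrow> (nat \<Rightarrow> nat) set" where
  "Sigma_L n P = {\<sigma> \<in> Sym n. \<forall>(i, j)\<in>P. \<sigma> i \<le> \<sigma> j}"

end

theory Submission
  imports Defs
begin

text \<open>If \<open>P\<close> is the poset of a labeling \<open>\<tau>\<close> of a skew diagram, then \<open>\<gamma> \<mapsto> \<gamma> \<circ> \<tau>\<close> identifies \<open>\<Sigma>\<^sub>L(P)\<close> with the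
  standard fillings of the diagram. The claim is that, for regular posets, the isomorphism type
  of the interval together with its descents amounts to the set of standard fillings, that is, to the
  shape.

  The link is the notion of a distinguished labeling: labels increase from a box to every other box
  weakly to its south-west. Such a labeling gives a regular poset and orders its components from the
  top by their labels. Conversely, in a Schur labeling labels increase to the south-west inside each
  component, and regularity separates the labels of different components. So the regular Schur
  labeled posets are the posets of distinguished labelings (\<open>RSP_iff\<close>); since the poset and the
  labels determine the order of rows and columns, the distinguished labeling is unique and
  it is the canonical one (\<open>tau_poset\<close>).

  The weak order is containment of inversion sets (\<open>weak_order_iff\<close>). For a distinguished labeling the
  order of two labels can be read off the positions of their boxes in every case that
  matters: when the boxes are incomparable, which is where members of the interval differ, and when
  they receive consecutive values, which is where descents are decided. Therefore the weak order and
  the descents of \<open>\<gamma>\<close> depend only on the filling \<open>\<gamma> \<circ> \<tau>\<close>, and two posets with the same shape have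
  equivalent intervals (\<open>same_shape_descent_equiv\<close>).

  For the other inclusion, let \<open>f\<close> be a descent-preserving isomorphism from \<open>\<Sigma>\<^sub>L(P)\<close> to an interval \<open>J\<close>.
  A cover by \<open>s\<^sub>i\<close> creates the descent \<open>i\<close> and no other, so \<open>f\<close> maps covers by \<open>s\<^sub>i\<close> to covers by
  \<open>s\<^sub>i\<close>. Hence \<open>f\<close> is multiplication on the right by some \<open>\<pi>\<close> (\<open>descent_iso_right_mult\<close>), and \<open>J\<close> consists of
  the linear extensions of the poset of \<open>\<pi>\<^sup>-\<^sup>1 \<circ> \<tau>\<close>. Every two boxes that are incomparable or adjacent
  receive consecutive values in some linear extension; preservation of its descents says
  that \<open>\<pi>\<^sup>-\<^sup>1\<close> keeps the order of their labels. Thus \<open>\<pi>\<^sup>-\<^sup>1 \<circ> \<tau>\<close> is again distinguished, of the same shape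
  (\<open>distinguished_of_descent_preserving\<close>).\<close>

section \<open>The weak order as containment of inversion sets\<close>

text \<open>Inversions are recorded by positions, not by values: multiplying by a simple transposition on the
  left exchanges two consecutive values, so it changes this set by a single pair, and the left weak
  order becomes containment.\<close>
definition Inv :: "nat \<Rightarrow> (nat \<Rightarrow> nat) \<Rightarrow> (nat \<times> nat) set" where
  "Inv n \<sigma> = {(a, b). 1 \<le> a \<and> a < b \<and> b \<le> n \<and> \<sigma> b < \<sigma> a}"

lemma finite_Inv [simp]: "finite (Inv n \<sigma>)"
  by (rule finite_subset[of _ "{1..n} \<times> {1..n}"]) (auto simp: Inv_def)

lemma simple_transp_comp_Sym:
  "\<sigma> \<in> Sym n \<Longrightarrow> i \<in> {1..<n} \<Longrightarrow> simple_transp i \<circ> \<sigma> \<in> Sym n"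
  unfolding Sym_def simple_transp_def
  by (auto intro!: permutes_compose permutes_swap_id)

lemma simple_transp_comp_twice [simp]: "simple_transp i \<circ> (simple_transp i \<circ> \<sigma>) = \<sigma>"
  by (auto simp: simple_transp_def fun_eq_iff)

lemma Sym_apply_inv [simp]: "\<sigma> \<in> Sym n \<Longrightarrow> \<sigma> (inv \<sigma> x) = x"
  and Sym_inv_apply [simp]: "\<sigma> \<in> Sym n \<Longrightarrow> inv \<sigma> (\<sigma> x) = x"
  by (auto simp: Sym_def permutes_inverses)

lemma Sym_mem [simp]: "\<sigma> \<in> Sym n \<Longrightarrow> \<sigma> x \<in> {1..n} \<longleftrightarrow> x \<in> {1..n}"
  by (auto simp: Sym_def permutes_in_image simp del: atLeastAtMost_iff)

lemma Sym_inv: "\<sigma> \<in> Sym n \<Longrightarrow> inv \<sigma> \<in> Sym n"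
  by (simp add: Sym_def permutes_inv)

lemma Sym_comp: "\<sigma> \<in> Sym n \<Longrightarrow> \<rho> \<in> Sym n \<Longrightarrow> \<sigma> \<circ> \<rho> \<in> Sym n"
  by (simp add: Sym_def permutes_compose)

lemma Sym_eq_iff [simp]: "\<sigma> \<in> Sym n \<Longrightarrow> \<sigma> x = \<sigma> y \<longleftrightarrow> x = y"
  by (metis Sym_inv_apply)

lemma inv_simple_transp_comp:
  assumes "\<sigma> \<in> Sym n" "i \<in> {1..<n}"
  shows "inv (simple_transp i \<circ> \<sigma>) j = inv \<sigma> (simple_transp i j)"
proof -
  have "(simple_transp i \<circ> \<sigma>) (inv \<sigma> (simple_transp i j)) = j"
    using assms by (simp add: simple_transp_def)
  then show ?thesis using Sym_inv_apply[OF simple_transp_comp_Sym[OF assms]] by metis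
qed

lemma Inv_simple_transp_ascent:
  assumes s: "\<sigma> \<in> Sym n" and i: "i \<in> {1..<n}" and lt: "inv \<sigma> i < inv \<sigma> (i + 1)"
  shows "Inv n (simple_transp i \<circ> \<sigma>) = insert (inv \<sigma> i, inv \<sigma> (i + 1)) (Inv n \<sigma>)"
proof -
  have rng: "inv \<sigma> i \<in> {1..n}" "inv \<sigma> (i + 1) \<in> {1..n}"
    using Sym_mem[OF Sym_inv[OF s]] i by auto
  have "(a, b) \<in> Inv n (simple_transp i \<circ> \<sigma>) \<longleftrightarrow> (a, b) \<in> insert (inv \<sigma> i, inv \<sigma> (i + 1)) (Inv n \<sigma>)"
    if "a < b" for a b
  proof -
    have ne: "\<sigma> a \<noteq> \<sigma> b" using s that by simp
    have e: "a = inv \<sigma> x \<longleftrightarrow> \<sigma> a = x" "b = inv \<sigma> x \<longleftrightarrow> \<sigma> b = x" for x using s by auto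
    have "\<not> (\<sigma> a = i + 1 \<and> \<sigma> b = i)"
    proof
      assume "\<sigma> a = i + 1 \<and> \<sigma> b = i"
      then have "a = inv \<sigma> (i + 1)" "b = inv \<sigma> i" using e by blast+
      then show False using lt that by simp
    qed
    then have "(simple_transp i (\<sigma> b) < simple_transp i (\<sigma> a)) \<longleftrightarrow> (\<sigma> a = i \<and> \<sigma> b = i + 1) \<or> \<sigma> b < \<sigma> a"
      using ne by (auto simp: simple_transp_def transpose_def)
    moreover have "\<sigma> a = i \<and> \<sigma> b = i + 1 \<longleftrightarrow> a = inv \<sigma> i \<and> b = inv \<sigma> (i + 1)" using e by blast
    ultimately show ?thesis using rng that by (auto simp: Inv_def)
  qed
  moreover have "x < y" if "(x, y) \<in> Inv n (simple_transp i \<circ> \<sigma>) \<or> (x, y) \<in> insert (inv \<sigma> i, inv \<sigma> (i + 1)) (Inv n \<sigma>)" for x y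
    using that lt by (auto simp: Inv_def)
  ultimately show ?thesis by auto
qed

lemma card_Inv_simple_transp_ascent:
  assumes "\<sigma> \<in> Sym n" "i \<in> {1..<n}" "inv \<sigma> i < inv \<sigma> (i + 1)"
  shows "card (Inv n (simple_transp i \<circ> \<sigma>)) = card (Inv n \<sigma>) + 1"
proof -
  have "(inv \<sigma> i, inv \<sigma> (i + 1)) \<notin> Inv n \<sigma>" using assms by (auto simp: Inv_def)
  then show ?thesis using Inv_simple_transp_ascent[OF assms] by simp
qed

lemma card_Inv_simple_transp_descent:
  assumes s: "\<sigma> \<in> Sym n" and i: "i \<in> {1..<n}" and lt: "inv \<sigma> (i + 1) < inv \<sigma> i"
  shows "card (Inv n \<sigma>) = card (Inv n (simple_transp i \<circ> \<sigma>)) + 1"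
  using card_Inv_simple_transp_ascent[OF simple_transp_comp_Sym[OF s i] i] lt
  by (simp add: inv_simple_transp_comp[OF s i]) (simp add: simple_transp_def)

lemma card_Inv_simple_transp_le:
  assumes s: "\<sigma> \<in> Sym n" and i: "i \<in> {1..<n}"
  shows "card (Inv n (simple_transp i \<circ> \<sigma>)) \<le> card (Inv n \<sigma>) + 1"
  using card_Inv_simple_transp_ascent[OF s i] card_Inv_simple_transp_descent[OF s i]
    Sym_eq_iff[OF Sym_inv[OF s], of i "i + 1"] by fastforce

lemma Sym_increasing_eq_id:
  assumes p: "p \<in> Sym n" and step: "\<And>i. i \<in> {1..<n} \<Longrightarrow> p i < p (i + 1)"
  shows "p = id"
proof -
  have "1 \<le> i \<Longrightarrow> i \<le> n \<Longrightarrow> i \<le> p i" for i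
  proof (induction i)
    case (Suc i)
    show ?case
    proof (cases "i = 0")
      case True
      then show ?thesis using Sym_mem[OF p, of 1] Suc by auto
    next
      case False
      then show ?thesis using Suc step[of i] by auto
    qed
  qed simp
  then show ?thesis using p permutes_natset_ge[of p "{1..n}"] by (auto simp: Sym_def)
qed

text \<open>The one idea behind the weak order: if no inversion of \<open>\<rho>\<close> could be added to those of \<open>\<sigma>\<close> by
  exchanging two consecutive values of \<open>\<sigma>\<close>, then \<open>\<rho>\<close> would increase along the positions of
  \<open>1, 2, \<dots>, n\<close> in \<open>\<sigma>\<close>, which forces \<open>\<rho> = \<sigma>\<close>.\<close>
lemma exists_step_towards:
  assumes s: "\<sigma> \<in> Sym n" and r: "\<rho> \<in> Sym n" and sub: "Inv n \<sigma> \<subseteq> Inv n \<rho>" and ne: "\<sigma> \<noteq> \<rho>"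
  obtains i where "i \<in> {1..<n}" "inv \<sigma> i < inv \<sigma> (i + 1)" "Inv n (simple_transp i \<circ> \<sigma>) \<subseteq> Inv n \<rho>"
proof (rule ccontr)
  assume no: "\<not> thesis"
  note goal = that
  let ?p = "\<rho> \<circ> inv \<sigma>"
  have p: "?p \<in> Sym n" using Sym_comp[OF r Sym_inv[OF s]] .
  have step: "?p i < ?p (i + 1)" if i: "i \<in> {1..<n}" for i
  proof (rule ccontr)
    assume a: "\<not> ?p i < ?p (i + 1)"
    then have gt: "?p (i + 1) < ?p i" using Sym_eq_iff[OF p, of i "i + 1"] by linarith
    have rng: "inv \<sigma> i \<in> {1..n}" "inv \<sigma> (i + 1) \<in> {1..n}"
      using Sym_mem[OF Sym_inv[OF s]] i by auto
    consider "inv \<sigma> i < inv \<sigma> (i + 1)" | "inv \<sigma> (i + 1) < inv \<sigma> i"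
      using Sym_eq_iff[OF Sym_inv[OF s], of i "i + 1"] by linarith
    then show False
    proof cases
      case 1
      then have "(inv \<sigma> i, inv \<sigma> (i + 1)) \<in> Inv n \<rho>" using gt rng by (auto simp: Inv_def)
      then show False using no goal[OF i 1] Inv_simple_transp_ascent[OF s i 1] sub by auto
    next
      case 2
      then have "(inv \<sigma> (i + 1), inv \<sigma> i) \<in> Inv n \<sigma>" using rng s by (auto simp: Inv_def)
      then show False using sub gt by (auto simp: Inv_def)
    qed
  qed
  have "?p = id" using Sym_increasing_eq_id[OF p] step by blast
  then have "\<rho> x = \<sigma> x" for x using s by (metis Sym_inv_apply comp_apply id_apply)
  then show False using ne by auto
qed

text \<open>Were the permutations different, a step from one towards the other would add an inversion that
  the target does not have.\<close>
lemma Inv_inj: "\<sigma> \<in> Sym n \<Longrightarrow> \<rho> \<in> Sym n \<Longrightarrow> Inv n \<sigma> = Inv n \<rho> \<Longrightarrow> \<sigma> = \<rho>"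
  using exists_step_towards[of \<sigma> n \<rho>] card_Inv_simple_transp_ascent[of \<sigma> n]
  by (metis card_mono finite_Inv not_add_less1 order_refl less_add_one not_le)

lemma word_Cons:
  "foldr (\<circ>) (map simple_transp (i # w)) id = simple_transp i \<circ> foldr (\<circ>) (map simple_transp w) id"
  by simp

lemma word_Sym:
  "set w \<subseteq> {1..<n} \<Longrightarrow> foldr (\<circ>) (map simple_transp w) id \<in> Sym n"
proof (induction w)
  case Nil
  show ?case by (simp add: Sym_def permutes_id[unfolded id_def])
next
  case (Cons i w)
  then have w: "set w \<subseteq> {1..<n}" "i \<in> {1..<n}" by auto
  show ?case unfolding word_Cons by (rule simple_transp_comp_Sym[OF Cons.IH[OF w(1)] w(2)])
qed

lemma card_Inv_word_le:
  "set w \<subseteq> {1..<n} \<Longrightarrow> card (Inv n (foldr (\<circ>) (map simple_transp w) id)) \<le> length w"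
proof (induction w)
  case Nil
  have "Inv n (\<lambda>a. a) = {}" by (auto simp: Inv_def)
  then show ?case by simp
next
  case (Cons i w)
  then have w: "set w \<subseteq> {1..<n}" "i \<in> {1..<n}" by auto
  show ?case unfolding word_Cons
    using card_Inv_simple_transp_le[OF word_Sym[OF w(1)] w(2)] Cons.IH[OF w(1)] by (simp only: length_Cons)
qed

text \<open>A permutation other than the identity has a descent, and undoing it removes one inversion.\<close>
lemma exists_reduced_word:
  "\<sigma> \<in> Sym n \<Longrightarrow> \<exists>w. length w = card (Inv n \<sigma>) \<and> set w \<subseteq> {1..<n} \<and>
     foldr (\<circ>) (map simple_transp w) id = \<sigma>"
proof (induction "card (Inv n \<sigma>)" arbitrary: \<sigma>)
  case 0
  have "id \<in> Sym n" by (simp add: Sym_def permutes_id)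
  moreover have "Inv n id = {}" by (auto simp: Inv_def)
  ultimately have "\<sigma> = id" using Inv_inj[of \<sigma> n id] 0 by simp
  then show ?case using 0 by (intro exI[of _ "[]"]) auto
next
  case (Suc k)
  have "\<exists>i\<in>{1..<n}. inv \<sigma> (i + 1) < inv \<sigma> i"
  proof (rule ccontr)
    assume a: "\<not> ?thesis"
    have "inv \<sigma> i < inv \<sigma> (i + 1)" if "i \<in> {1..<n}" for i
    proof -
      have "inv \<sigma> i \<noteq> inv \<sigma> (i + 1)" using Sym_eq_iff[OF Sym_inv[OF Suc.prems]] by simp
      then show ?thesis using a that by (meson linorder_neqE_nat)
    qed
    then have "inv \<sigma> = id" using Sym_increasing_eq_id[OF Sym_inv[OF Suc.prems]] by blast
    then have "\<sigma> = id" using Suc.prems by (metis Sym_inv_apply eq_id_iff)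
    then have "Inv n \<sigma> = {}" by (auto simp: Inv_def)
    then show False using Suc.hyps(2) by simp
  qed
  then obtain i where i: "i \<in> {1..<n}" "inv \<sigma> (i + 1) < inv \<sigma> i" by blast
  let ?r = "simple_transp i \<circ> \<sigma>"
  have "card (Inv n ?r) = k" using card_Inv_simple_transp_descent[OF Suc.prems i] Suc.hyps(2) by simp
  then obtain w where "length w = k" "set w \<subseteq> {1..<n}" "foldr (\<circ>) (map simple_transp w) id = ?r"
    using Suc.hyps(1)[of ?r] simple_transp_comp_Sym[OF Suc.prems i(1)] by auto
  then show ?case using i Suc.hyps(2) by (intro exI[of _ "i # w"]) auto
qed

lemma perm_length_eq_card_Inv: "\<sigma> \<in> Sym n \<Longrightarrow> perm_length n \<sigma> = card (Inv n \<sigma>)"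
  unfolding perm_length_def
  by (rule Least_equality) (use exists_reduced_word card_Inv_word_le in blast)+

lemma Des_L_iff:
  assumes s: "\<sigma> \<in> Sym n"
  shows "i \<in> Des_L n \<sigma> \<longleftrightarrow> i \<in> {1..<n} \<and> inv \<sigma> (i + 1) < inv \<sigma> i"
proof (cases "i \<in> {1..<n}")
  case True
  then show ?thesis
    using card_Inv_simple_transp_ascent[OF s True] card_Inv_simple_transp_descent[OF s True]
      Sym_eq_iff[OF Sym_inv[OF s], of i "i + 1"] simple_transp_comp_Sym[OF s True] s
    by (cases "inv \<sigma> i < inv \<sigma> (i + 1)") (auto simp: Des_L_def perm_length_eq_card_Inv)
qed (auto simp: Des_L_def)

lemma weak_cover_iff:
  "(\<sigma>, \<rho>) \<in> weak_cover n \<longleftrightarrow>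
     \<sigma> \<in> Sym n \<and> (\<exists>i\<in>{1..<n}. inv \<sigma> i < inv \<sigma> (i + 1) \<and> \<rho> = simple_transp i \<circ> \<sigma>)"
proof -
  have "card (Inv n (simple_transp i \<circ> \<sigma>)) > card (Inv n \<sigma>) \<longleftrightarrow> inv \<sigma> i < inv \<sigma> (i + 1)"
    if "\<sigma> \<in> Sym n" "i \<in> {1..<n}" for i
    using card_Inv_simple_transp_ascent[OF that] card_Inv_simple_transp_descent[OF that]
      Sym_eq_iff[OF Sym_inv[OF that(1)], of i "i + 1"] 
    by (cases "inv \<sigma> i < inv \<sigma> (i + 1)") auto
  then show ?thesis
    unfolding weak_cover_def using simple_transp_comp_Sym[of \<sigma> n]
    by (auto simp: perm_length_eq_card_Inv)
qed

lemma weak_order_iff: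
  "(\<sigma>, \<rho>) \<in> weak_order n \<longleftrightarrow> \<sigma> \<in> Sym n \<and> \<rho> \<in> Sym n \<and> Inv n \<sigma> \<subseteq> Inv n \<rho>"
proof -
  have "Inv n \<sigma> \<subseteq> Inv n \<rho>" if "(\<sigma>, \<rho>) \<in> (weak_cover n)\<^sup>*"
    using that
  proof (induction rule: rtrancl_induct)
    case (step \<gamma> \<delta>)
    then show ?case using Inv_simple_transp_ascent[of \<gamma> n] by (fastforce simp: weak_cover_iff)
  qed simp
  moreover have "(\<sigma>, \<rho>) \<in> (weak_cover n)\<^sup>*"
    if "\<sigma> \<in> Sym n" "\<rho> \<in> Sym n" "Inv n \<sigma> \<subseteq> Inv n \<rho>"
    using that
  proof (induction "card (Inv n \<rho>) - card (Inv n \<sigma>)" arbitrary: \<sigma> rule: less_induct)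
    case less
    show ?case
    proof (cases "\<sigma> = \<rho>")
      case False
      then obtain i where i: "i \<in> {1..<n}" "inv \<sigma> i < inv \<sigma> (i + 1)"
        and sub: "Inv n (simple_transp i \<circ> \<sigma>) \<subseteq> Inv n \<rho>"
        using exists_step_towards less.prems by metis
      let ?t = "simple_transp i \<circ> \<sigma>"
      have t: "?t \<in> Sym n" using simple_transp_comp_Sym less.prems i by blast
      have "card (Inv n ?t) = card (Inv n \<sigma>) + 1"
        using card_Inv_simple_transp_ascent less.prems(1) i by blast
      moreover have "card (Inv n ?t) \<le> card (Inv n \<rho>)" using sub by (simp add: card_mono)
      ultimately have "(?t, \<rho>) \<in> (weak_cover n)\<^sup>*" using less.hyps[OF _ t _ sub] less.prems by simp
      moreover have "(\<sigma>, ?t) \<in> weak_cover n" using less.prems i weak_cover_iff by blast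
      ultimately show ?thesis by (rule converse_rtrancl_into_rtrancl[rotated])
    qed simp
  qed
  ultimately show ?thesis by (auto simp: weak_order_def)
qed

section \<open>Skew diagrams as order convex sets of boxes\<close>

text \<open>Basic skew diagrams are the finite convex sets of boxes whose rows and columns are numbered
  from 1 without gaps (shown by \<open>diagram_order_convex\<close> and \<open>exists_basic_of_convex\<close>). In this form connected components
  can be moved around without computing with partitions.\<close>
definition order_convex :: "box set \<Rightarrow> bool" where
  "order_convex D \<longleftrightarrow> (\<forall>a\<in>D. \<forall>b\<in>D. \<forall>i j.
     fst a \<le> i \<and> i \<le> fst b \<and> snd a \<le> j \<and> j \<le> snd b \<longrightarrow> (i, j) \<in> D)"

lemma order_convexD:
  "order_convex D \<Longrightarrow> a \<in> D \<Longrightarrow> b \<in> D \<Longrightarrow> fst a \<le> i \<Longrightarrow> i \<le> fst b \<Longrightarrow> snd a \<le> j \<Longrightarrow> j \<le> snd b \<Longrightarrow>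
    (i, j) \<in> D"
  unfolding order_convex_def by blast

lemma part_antimono:
  assumes "is_partition p" "1 \<le> i" "i \<le> j"
  shows "part p j \<le> part p i"
proof (cases "i = j \<or> length p < j")
  case False
  then have "p ! (j - 1) \<le> p ! (i - 1)"
    using assms by (auto simp: is_partition_def sorted_wrt_iff_nth_less)
  then show ?thesis using False assms by (auto simp: part_def)
qed (auto simp: part_def)

lemma part_pos_iff:
  assumes "is_partition p" shows "0 < part p i \<longleftrightarrow> 1 \<le> i \<and> i \<le> length p"
proof (cases "1 \<le> i \<and> i \<le> length p")
  case True
  then have "p ! (i - 1) \<in> set p" by auto
  then have "p ! (i - 1) \<noteq> 0" using assms unfolding is_partition_def by metis
  then show ?thesis using True by (simp add: part_def)
qed (auto simp: part_def)

lemma partition_eqI: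
  assumes "is_partition p" "is_partition q" "\<And>i. 1 \<le> i \<Longrightarrow> part p i = part q i"
  shows "p = q"
proof -
  have "i \<le> length p \<longleftrightarrow> i \<le> length q" if "1 \<le> i" for i
    using assms(3)[OF that] part_pos_iff[OF assms(1), of i] part_pos_iff[OF assms(2), of i] that by auto
  from this[of "length p"] this[of "length q"] have l: "length p = length q"
    by (metis One_nat_def Suc_leI le_antisym neq0_conv order_refl zero_le)
  show ?thesis
  proof (rule nth_equalityI[OF l])
    fix i assume "i < length p"
    then show "p ! i = q ! i" using assms(3)[of "i + 1"] l by (simp add: part_def)
  qed
qed

lemma finite_diagram: "is_skew S \<Longrightarrow> finite (diagram S)"
proof (rule finite_subset)
  assume S: "is_skew S"
  show "diagram S \<subseteq> {1..length (fst S)} \<times> {1..part (fst S) 1}"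
  proof clarify
    fix i j assume "(i, j) \<in> diagram S"
    then have "1 \<le> i" "0 < part (fst S) i" "1 \<le> j" "j \<le> part (fst S) i" by (auto simp: diagram_def)
    then show "i \<in> {1..length (fst S)} \<and> j \<in> {1..part (fst S) 1}"
      using S part_pos_iff[of "fst S" i] part_antimono[of "fst S" 1 i] by (auto simp: is_skew_def)
  qed
qed simp

lemma diagram_order_convex:
  assumes "is_skew S"
  shows "order_convex (diagram S)"
  unfolding order_convex_def
proof clarsimp
  fix r c s d i j
  assume *: "(r, c) \<in> diagram S" "(s, d) \<in> diagram S" "r \<le> i" "i \<le> s" "c \<le> j" "j \<le> d"
  then have "part (snd S) i \<le> part (snd S) r" "part (fst S) s \<le> part (fst S) i"
    using assms by (auto simp: is_skew_def diagram_def intro: part_antimono)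
  then show "(i, j) \<in> diagram S" using * by (auto simp: diagram_def)
qed

lemma basic_rows:
  assumes S: "basic S" shows "fst ` diagram S = {1..length (fst S)}"
proof
  show "fst ` diagram S \<subseteq> {1..length (fst S)}"
    using S part_pos_iff[of "fst S"] by (fastforce simp: diagram_def basic_def is_skew_def)
  show "{1..length (fst S)} \<subseteq> fst ` diagram S"
  proof
    fix i assume "i \<in> {1..length (fst S)}"
    then obtain j where "(i, j) \<in> diagram S" using S unfolding basic_def by blast
    then show "i \<in> fst ` diagram S" by (rule rev_image_eqI) simp
  qed
qed

lemma basic_cols:
  assumes S: "basic S" shows "snd ` diagram S = {1..part (fst S) 1}"
proof
  show "snd ` diagram S \<subseteq> {1..part (fst S) 1}"
  proof clarsimp
    fix i j assume "(i, j) \<in> diagram S"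
    then show "Suc 0 \<le> j \<and> j \<le> part (fst S) (Suc 0)"
      using S part_antimono[of "fst S" 1 i] by (auto simp: diagram_def basic_def is_skew_def)
  qed
  show "{1..part (fst S) 1} \<subseteq> snd ` diagram S"
  proof
    fix j assume "j \<in> {1..part (fst S) 1}"
    then obtain i where "(i, j) \<in> diagram S" using S unfolding basic_def by blast
    then show "j \<in> snd ` diagram S" by (rule rev_image_eqI) simp
  qed
qed

lemma basic_diagram_inject:
  assumes S: "basic S" and S': "basic S'" and eq: "diagram S = diagram S'"
  shows "S = S'"
proof -
  have sk: "is_skew S" "is_skew S'" using S S' by (auto simp: basic_def)
  have same: "part (fst S) i = part (fst S') i \<and> part (snd S) i = part (snd S') i" if i: "1 \<le> i" for i
  proof -
    have iff: "part (snd S) i < j \<and> j \<le> part (fst S) i \<longleftrightarrow> part (snd S') i < j \<and> j \<le> part (fst S') i" for j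
      using eq i by (auto simp: diagram_def set_eq_iff)
    show ?thesis
    proof (cases "i \<in> fst ` diagram S")
      case True
      then have "part (snd S) i < part (fst S) i" by (auto simp: diagram_def)
      then show ?thesis
        using iff[of "part (fst S) i"] iff[of "part (fst S') i"] iff[of "Suc (part (snd S) i)"]
          iff[of "Suc (part (snd S') i)"] by linarith
    next
      case False
      then have "part (fst S) i = 0" "part (fst S') i = 0"
        using basic_rows[OF S] basic_rows[OF S'] eq part_pos_iff i sk unfolding is_skew_def
        by (metis atLeastAtMost_iff gr0I)+
      then show ?thesis using sk i unfolding is_skew_def by (metis le_zero_eq)
    qed
  qed
  have "fst S = fst S'" "snd S = snd S'"
    using sk same by (auto simp: is_skew_def intro!: partition_eqI)
  then show ?thesis by (rule prod_eqI)
qed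

text \<open>The row of index \<open>i\<close> is an interval by convexity; its end \<open>L i\<close> and the column \<open>U i\<close> before its
  start both weakly decrease with \<open>i\<close>, since a violation would put a box beyond the end of the upper
  row or before the start of the lower one. These numbers are the two partitions, up to the zeros at
  the end of the second one.\<close>
lemma exists_basic_of_convex:
  assumes cv: "order_convex D" and fin: "finite D"
    and rows: "fst ` D = {1..k}" and cols: "snd ` D = {1..m}"
  shows "\<exists>S. basic S \<and> diagram S = D"
proof -
  define row where "row i = {j. (i, j) \<in> D}" for i
  define L where "L i = Max (row i)" for i
  define U where "U i = Min (row i) - 1" for i
  have mem: "i \<in> {1..k} \<and> j \<in> {1..m}" if "(i, j) \<in> D" for i j
    using imageI[OF that, of fst] imageI[OF that, of snd] rows cols by simp
  have finr: "finite (row i)" for i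
    by (rule finite_subset[of _ "{1..m}"]) (use mem in \<open>auto simp: row_def\<close>)
  have ne: "row i \<noteq> {} \<longleftrightarrow> 1 \<le> i \<and> i \<le> k" for i
  proof -
    have "row i \<noteq> {} \<longleftrightarrow> i \<in> fst ` D" by (auto simp: row_def intro: rev_image_eqI)
    then show ?thesis using rows by simp
  qed
  have pos: "1 \<le> j" if "j \<in> row i" for i j using that mem by (auto simp: row_def)
  have Lin: "(i, L i) \<in> D" and Min_in: "(i, Min (row i)) \<in> D" if "1 \<le> i" "i \<le> k" for i
    using Max_in[OF finr] Min_in[OF finr] ne that by (auto simp: L_def row_def)
  have D: "(i, j) \<in> D \<longleftrightarrow> 1 \<le> i \<and> i \<le> k \<and> U i < j \<and> j \<le> L i" for i j
  proof (cases "1 \<le> i \<and> i \<le> k")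
    case True
    have m: "1 \<le> Min (row i)" using Min_in pos[of "Min (row i)" i] True by (auto simp: row_def)
    have "(i, j) \<in> D \<longleftrightarrow> Min (row i) \<le> j \<and> j \<le> L i"
    proof
      assume "(i, j) \<in> D"
      then have "j \<in> row i" by (simp add: row_def)
      then show "Min (row i) \<le> j \<and> j \<le> L i" using Min_le[OF finr] Max_ge[OF finr] by (simp add: L_def)
    next
      assume "Min (row i) \<le> j \<and> j \<le> L i"
      then show "(i, j) \<in> D" using order_convexD[OF cv Min_in[of i] Lin[of i], of i j] True by simp
    qed
    then show ?thesis using m True by (auto simp: U_def)
  next
    case False
    then have "row i = {}" using ne by blast
    then show ?thesis using False by (auto simp: row_def)
  qed
  have UL: "U i < L i" if "1 \<le> i" "i \<le> k" for i using D[of i "L i"] Lin that by blast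
  have mono: "L j \<le> L i \<and> U j \<le> U i" if "1 \<le> i" "i \<le> j" "j \<le> k" for i j
  proof -
    have a: "(i, U i + 1) \<in> D" "(j, L j) \<in> D" "(i, L i) \<in> D" "(j, U j + 1) \<in> D"
      using D UL that by (auto simp: Suc_le_eq)
    have "L j \<le> L i"
      using order_convexD[OF cv a(3) a(2), of i "L j"] D[of i "L j"] that by (cases "L i \<le> L j") auto
    moreover have "U j \<le> U i"
      using order_convexD[OF cv a(1) a(4), of j "U i + 1"] D[of j "U i + 1"] that by (cases "U i \<le> U j") auto
    ultimately show ?thesis ..
  qed
  define la where "la = map L [Suc 0..<Suc k]"
  define mu where "mu = takeWhile (\<lambda>x. 0 < x) (map U [Suc 0..<Suc k])"
  have la: "is_partition la"
  proof -
    have "sorted_wrt (\<ge>) la" using mono by (simp add: la_def sorted_wrt_iff_nth_less del: upt_Suc)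
    moreover have "x \<noteq> 0" if "x \<in> set la" for x
    proof -
      have "set la = L ` {1..k}"
        by (simp add: la_def atLeastLessThanSuc_atLeastAtMost del: upt_Suc)
      then obtain i where "x = L i" "1 \<le> i" "i \<le> k" using \<open>x \<in> set la\<close> by auto
      then show ?thesis using UL[of i] by simp
    qed
    ultimately show ?thesis unfolding is_partition_def by blast
  qed
  have pla: "part la i = (if 1 \<le> i \<and> i \<le> k then L i else 0)" for i
    by (auto simp: part_def la_def simp del: upt_Suc)
  have srt: "sorted_wrt (\<ge>) (map U [Suc 0..<Suc k])" using mono by (simp add: sorted_wrt_iff_nth_less del: upt_Suc)
  have mu: "is_partition mu"
  proof -
    have "sorted_wrt (\<ge>) mu"
      unfolding mu_def by (subst takeWhile_eq_take) (rule sorted_wrt_take[OF srt])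
    moreover have "0 \<notin> set mu" unfolding mu_def by (blast dest: set_takeWhileD)
    ultimately show ?thesis by (simp add: is_partition_def)
  qed
  have pmu: "part mu i = (if 1 \<le> i \<and> i \<le> k then U i else 0)" for i
  proof (cases "1 \<le> i \<and> i \<le> length mu")
    case True
    have lk: "length mu \<le> k" unfolding mu_def by (rule order_trans[OF length_takeWhile_le]) (simp del: upt_Suc)
    have "mu ! (i - 1) = map U [Suc 0..<Suc k] ! (i - 1)"
      unfolding mu_def by (rule takeWhile_nth) (use True in \<open>auto simp add: mu_def[symmetric] simp del: upt_Suc\<close>)
    then show ?thesis using True lk by (auto simp: part_def simp del: upt_Suc)
  next
    case False
    have "U i = 0" if i: "1 \<le> i" "i \<le> k"
    proof -
      have "length mu < i" using False i by simp
      then have l: "length mu < k" using i by simp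
      have "\<not> 0 < map U [Suc 0..<Suc k] ! length mu"
        unfolding mu_def by (rule nth_length_takeWhile) (use l in \<open>simp add: mu_def[symmetric] del: upt_Suc\<close>)
      then have "U (length mu + 1) = 0" using l by (simp del: upt_Suc)
      then show ?thesis using mono[of "length mu + 1" i] \<open>length mu < i\<close> i by simp
    qed
    then show ?thesis using False by (auto simp: part_def)
  qed
  have dg: "diagram (la, mu) = D"
    using D by (auto simp: diagram_def pla pmu split: if_splits)
  have "is_skew (la, mu)" using la mu UL by (auto simp: is_skew_def pla pmu less_imp_le)
  moreover have "\<forall>i\<in>{1..length (fst (la, mu))}. \<exists>j. (i, j) \<in> D"
    using Lin by (auto simp: la_def simp del: upt_Suc intro!: exI[of _ "L _"])
  moreover have "\<forall>j\<in>{1..part (fst (la, mu)) 1}. \<exists>i. (i, j) \<in> D"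
  proof
    fix j assume j: "j \<in> {1..part (fst (la, mu)) 1}"
    then have "1 \<le> k" by (auto simp: pla split: if_splits)
    then have "L 1 \<in> snd ` D" using Lin[of 1] by force
    then have "j \<in> snd ` D" using j cols by (auto simp: pla split: if_splits)
    then show "\<exists>i. (i, j) \<in> D" by auto
  qed
  ultimately have "basic (la, mu)" unfolding basic_def dg by blast
  then show ?thesis using dg by blast
qed

definition rank_in :: "nat set \<Rightarrow> nat \<Rightarrow> nat" where
  "rank_in A x = card {y \<in> A. y \<le> x}"

lemma rank_in_less: "finite A \<Longrightarrow> y \<in> A \<Longrightarrow> x < y \<Longrightarrow> rank_in A x < rank_in A y"
  unfolding rank_in_def by (rule psubset_card_mono) force+

lemma rank_in_mono: "finite A \<Longrightarrow> x \<le> y \<Longrightarrow> rank_in A x \<le> rank_in A y"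
  unfolding rank_in_def by (rule card_mono) auto

lemma rank_in_less_iff: "finite A \<Longrightarrow> x \<in> A \<Longrightarrow> y \<in> A \<Longrightarrow> rank_in A x < rank_in A y \<longleftrightarrow> x < y"
  by (meson leD not_less rank_in_less rank_in_mono)

lemma rank_in_le_iff: "finite A \<Longrightarrow> x \<in> A \<Longrightarrow> y \<in> A \<Longrightarrow> rank_in A x \<le> rank_in A y \<longleftrightarrow> x \<le> y"
  by (meson leD not_less rank_in_less rank_in_mono)

lemma bij_betw_rank_in:
  assumes "finite A" shows "bij_betw (rank_in A) A {1..card A}"
proof -
  have "inj_on (rank_in A) A"
    by (rule inj_onI) (metis assms rank_in_le_iff order_antisym order_refl)
  moreover have "rank_in A ` A \<subseteq> {1..card A}"
  proof clarify
    fix x assume "x \<in> A"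
    then have "{y \<in> A. y \<le> x} \<noteq> {}" "{y \<in> A. y \<le> x} \<subseteq> A" by auto
    then show "rank_in A x \<in> {1..card A}"
      using assms by (auto simp: rank_in_def Suc_le_eq card_gt_0_iff intro: card_mono)
  qed
  ultimately show ?thesis
    by (simp add: bij_betw_def card_image card_subset_eq)
qed

text \<open>Deleting the empty rows and columns of a convex set of boxes leaves a basic skew diagram.\<close>
lemma exists_basic_compression:
  assumes cv: "order_convex D" and fin: "finite D"
  shows "\<exists>S. basic S \<and> diagram S = map_prod (rank_in (fst ` D)) (rank_in (snd ` D)) ` D"
proof -
  let ?f = "rank_in (fst ` D)" and ?g = "rank_in (snd ` D)"
  have bf: "bij_betw ?f (fst ` D) {1..card (fst ` D)}" and bg: "bij_betw ?g (snd ` D) {1..card (snd ` D)}"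
    using fin by (simp_all only: bij_betw_rank_in finite_imageI)
  have rows: "fst ` map_prod ?f ?g ` D = {1..card (fst ` D)}"
    using bf by (auto simp: bij_betw_def image_image)
  have cols: "snd ` map_prod ?f ?g ` D = {1..card (snd ` D)}"
    using bg by (auto simp: bij_betw_def image_image)
  have "order_convex (map_prod ?f ?g ` D)"
    unfolding order_convex_def
  proof clarsimp
    fix r c s d i j
    assume D: "(r, c) \<in> D" "(s, d) \<in> D" and le: "?f r \<le> i" "i \<le> ?f s" "?g c \<le> j" "j \<le> ?g d"
    have "?f r \<in> {1..card (fst ` D)}" "?f s \<in> {1..card (fst ` D)}"
      "?g c \<in> {1..card (snd ` D)}" "?g d \<in> {1..card (snd ` D)}"
      using bf bg D unfolding bij_betw_def by force+
    then have "i \<in> ?f ` fst ` D" "j \<in> ?g ` snd ` D" using bf bg le by (auto simp: bij_betw_def)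
    then obtain i' j' where ij: "i = ?f i'" "i' \<in> fst ` D" "j = ?g j'" "j' \<in> snd ` D" by blast
    have m: "r \<in> fst ` D" "s \<in> fst ` D" "c \<in> snd ` D" "d \<in> snd ` D" using D by force+
    have "r \<le> i'" "i' \<le> s" "c \<le> j'" "j' \<le> d"
      using le ij m fin by (simp_all add: rank_in_le_iff)
    then have "(i', j') \<in> D" using order_convexD[OF cv D] by simp
    then show "(i, j) \<in> map_prod ?f ?g ` D" using ij by force
  qed
  then show ?thesis using exists_basic_of_convex[OF _ _ rows cols] fin by blast
qed

section \<open>Connected components of a convex set of boxes\<close>

abbreviation conn :: "box set \<Rightarrow> (box \<times> box) set" where
  "conn D \<equiv> {(a, b). a \<in> D \<and> b \<in> D \<and> share_edge a b}\<^sup>*"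

text \<open>The south-east relation is weak and the south-west relation is strict in both coordinates, so two
  boxes are incomparable in the first sense exactly when they are comparable in the second.\<close>
definition SE :: "box \<Rightarrow> box \<Rightarrow> bool" where
  "SE a b \<longleftrightarrow> fst a \<le> fst b \<and> snd a \<le> snd b"

definition SW :: "box \<Rightarrow> box \<Rightarrow> bool" where
  "SW a b \<longleftrightarrow> fst a < fst b \<and> snd b < snd a"

lemma conn_sym: "(a, b) \<in> conn D \<Longrightarrow> (b, a) \<in> conn D"
proof -
  have "sym {(a, b). a \<in> D \<and> b \<in> D \<and> share_edge a b}"
    by (auto simp: sym_def share_edge_def)
  then show "(a, b) \<in> conn D \<Longrightarrow> (b, a) \<in> conn D" by (meson symD sym_rtrancl)
qed

lemma conn_class_eq:
  assumes "(a, b) \<in> conn D"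
  shows "conn D `` {a} = conn D `` {b}"
proof (rule set_eqI)
  fix x
  show "x \<in> conn D `` {a} \<longleftrightarrow> x \<in> conn D `` {b}"
    unfolding Image_singleton_iff using rtrancl_trans[OF assms] rtrancl_trans[OF conn_sym[OF assms]] by (rule iffI[rotated])
qed

lemma conn_closed: "(a, b) \<in> conn D \<Longrightarrow> a \<in> D \<Longrightarrow> b \<in> D"
  by (induction rule: rtrancl_induct) auto

text \<open>Convexity lets one walk from a box to any box to its south-east by single steps down or right.\<close>
lemma SE_imp_conn:
  assumes cv: "order_convex D" and "a \<in> D" "b \<in> D" "SE a b"
  shows "(a, b) \<in> conn D"
  using assms(2-)
proof (induction "(fst b - fst a) + (snd b - snd a)" arbitrary: a rule: less_induct)
  case less
  obtain r c where a: "a = (r, c)" by (cases a)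
  consider "a = b" | "r < fst b" | "c < snd b"
    using less.prems a by (fastforce simp: SE_def intro: prod_eqI)
  then show ?case
  proof cases
    case 2
    let ?a = "(r + 1, c)"
    have "?a \<in> D" using order_convexD[OF cv less.prems(1,2)] 2 less.prems a by (simp add: SE_def)
    moreover from this have "(?a, b) \<in> conn D"
      using less.hyps[of ?a] 2 less.prems a by (simp add: SE_def)
    ultimately show ?thesis
      using less.prems a by (auto simp: share_edge_def intro: converse_rtrancl_into_rtrancl)
  next
    case 3
    let ?a = "(r, c + 1)"
    have "?a \<in> D" using order_convexD[OF cv less.prems(1,2)] 3 less.prems a by (simp add: SE_def)
    moreover from this have "(?a, b) \<in> conn D"
      using less.hyps[of ?a] 3 less.prems a by (simp add: SE_def)
    ultimately show ?thesis
      using less.prems a by (auto simp: share_edge_def intro: converse_rtrancl_into_rtrancl)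
  qed simp
qed

lemma not_SE_iff_SW: "\<not> SE a b \<and> \<not> SE b a \<longleftrightarrow> SW a b \<or> SW b a"
  by (auto simp: SE_def SW_def)

lemma share_edge_SE: "share_edge a b \<Longrightarrow> SE a b \<or> SE b a"
  by (auto simp: share_edge_def SE_def)

text \<open>Walking inside a component cannot pass from the north-east of a box of another component to
  its south-west, since on the way the two boxes would be comparable, hence connected.\<close>
lemma SW_conn_left:
  assumes cv: "order_convex D" and "(a, a') \<in> conn D" "(a, b) \<notin> conn D" "a \<in> D" "b \<in> D" "SW a b"
  shows "SW a' b"
  using assms(2)
proof (induction rule: rtrancl_induct)
  case (step x y)
  have "(a, y) \<in> conn D" using step(1,2) by (rule rtrancl_into_rtrancl)
  then have "(y, b) \<notin> conn D" "(b, y) \<notin> conn D" using assms(3) conn_sym by (meson rtrancl_trans)+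
  then have "\<not> SE y b" "\<not> SE b y" using SE_imp_conn[OF cv] assms(5) step(2) by blast+
  then have "SW y b \<or> SW b y" using not_SE_iff_SW by blast
  then show ?case using step(2,3) by (auto simp: share_edge_def SW_def)
qed (use assms in simp)

lemma SW_conn_right:
  assumes cv: "order_convex D" and "(b, b') \<in> conn D" "(a, b) \<notin> conn D" "a \<in> D" "b \<in> D" "SW a b"
  shows "SW a b'"
  using assms(2)
proof (induction rule: rtrancl_induct)
  case (step x y)
  have "(b, y) \<in> conn D" using step(1,2) by (rule rtrancl_into_rtrancl)
  then have "(y, a) \<notin> conn D" "(a, y) \<notin> conn D" using assms(3) conn_sym by (meson rtrancl_trans)+
  then have "\<not> SE a y" "\<not> SE y a" using SE_imp_conn[OF cv] assms(4) step(2) by blast+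
  then have "SW a y \<or> SW y a" using not_SE_iff_SW by blast
  then show ?case using step(2,3) by (auto simp: share_edge_def SW_def)
qed (use assms in simp)

lemma SW_conn:
  assumes cv: "order_convex D" and "(a, a') \<in> conn D" "(b, b') \<in> conn D" "(a, b) \<notin> conn D" "a \<in> D" "b \<in> D"
    and "SW a b"
  shows "SW a' b'"
proof -
  have "SW a' b" using SW_conn_left assms by blast
  moreover have "(a', b) \<notin> conn D" using assms(2,4) by (meson rtrancl_trans)
  ultimately show ?thesis using SW_conn_right[OF cv assms(3)] conn_closed assms by blast
qed

section \<open>Distinguished labelings\<close>

text \<open>The condition combines the Schur condition in rows and columns with the requirement that labels
  increase from a box to any box strictly to its south-west: the labeling is a linear extension of
  the weak south-west order.\<close>
definition distinguished :: "nat \<Rightarrow> tableau \<Rightarrow> bool" where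
  "distinguished n \<tau> \<longleftrightarrow> bijective_tableau n \<tau> \<and>
     (\<forall>a\<in>diagram (sh \<tau>). \<forall>b\<in>diagram (sh \<tau>).
        fst a \<le> fst b \<and> snd b \<le> snd a \<and> a \<noteq> b \<longrightarrow> entry \<tau> a < entry \<tau> b)"

lemma bijective_tableauD:
  assumes "bijective_tableau n \<tau>"
  shows "basic (sh \<tau>)" "order_convex (diagram (sh \<tau>))" "finite (diagram (sh \<tau>))"
    "\<And>a. a \<in> diagram (sh \<tau>) \<Longrightarrow> entry \<tau> a \<in> {1..n}"
    "\<And>a b. a \<in> diagram (sh \<tau>) \<Longrightarrow> b \<in> diagram (sh \<tau>) \<Longrightarrow> entry \<tau> a = entry \<tau> b \<longleftrightarrow> a = b"
    "\<And>x. x \<in> {1..n} \<Longrightarrow> \<exists>a\<in>diagram (sh \<tau>). entry \<tau> a = x"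
proof -
  have b: "bij_betw (entry \<tau>) (diagram (sh \<tau>)) {1..n}" and s: "basic (sh \<tau>)"
    using assms by (auto simp: bijective_tableau_def)
  show "basic (sh \<tau>)" by fact
  then show "order_convex (diagram (sh \<tau>))" "finite (diagram (sh \<tau>))"
    using diagram_order_convex finite_diagram by (auto simp: basic_def)
  show "\<And>a. a \<in> diagram (sh \<tau>) \<Longrightarrow> entry \<tau> a \<in> {1..n}" using b bij_betwE by blast
  show "\<And>a b. a \<in> diagram (sh \<tau>) \<Longrightarrow> b \<in> diagram (sh \<tau>) \<Longrightarrow> entry \<tau> a = entry \<tau> b \<longleftrightarrow> a = b"
    using b by (meson bij_betw_def inj_on_eq_iff)
  show "\<And>x. x \<in> {1..n} \<Longrightarrow> \<exists>a\<in>diagram (sh \<tau>). entry \<tau> a = x"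
    using b unfolding bij_betw_def by (metis imageE)
qed

lemma diagram_bounded:
  assumes "bijective_tableau n \<tau>"
  obtains N where "\<And>a. a \<in> diagram (sh \<tau>) \<Longrightarrow> fst a < N \<and> snd a < N"
proof -
  have "finite (fst ` diagram (sh \<tau>) \<union> snd ` diagram (sh \<tau>))" using bijective_tableauD(3)[OF assms] by simp
  then obtain N where "\<forall>k \<in> fst ` diagram (sh \<tau>) \<union> snd ` diagram (sh \<tau>). k < N"
    using finite_nat_set_iff_bounded by blast
  then show thesis using that by blast
qed

lemma poset_entry_iff:
  assumes t: "bijective_tableau n \<tau>" and a: "a \<in> diagram (sh \<tau>)" and b: "b \<in> diagram (sh \<tau>)"
  shows "(entry \<tau> a, entry \<tau> b) \<in> poset \<tau> \<longleftrightarrow> SE a b"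
  using bijective_tableauD(5)[OF t] a b unfolding poset_def SE_def by blast

lemma distinguished_less:
  "distinguished n \<tau> \<Longrightarrow> a \<in> diagram (sh \<tau>) \<Longrightarrow> b \<in> diagram (sh \<tau>) \<Longrightarrow> fst a \<le> fst b \<Longrightarrow> snd b \<le> snd a \<Longrightarrow>
    a \<noteq> b \<Longrightarrow> entry \<tau> a < entry \<tau> b"
  unfolding distinguished_def by blast

lemma distinguished_SW_iff:
  assumes d: "distinguished n \<tau>" and a: "a \<in> diagram (sh \<tau>)" and b: "b \<in> diagram (sh \<tau>)"
  shows "SW a b \<longleftrightarrow> \<not> SE a b \<and> \<not> SE b a \<and> entry \<tau> a < entry \<tau> b"
proof -
  have "x \<noteq> y \<and> fst x \<le> fst y \<and> snd y \<le> snd x" if "SW x y" for x y using that by (auto simp: SW_def)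
  then have "entry \<tau> x < entry \<tau> y" if "SW x y" "x \<in> diagram (sh \<tau>)" "y \<in> diagram (sh \<tau>)" for x y
    using distinguished_less[OF d] that by blast
  then show ?thesis using not_SE_iff_SW[of a b] a b by (meson less_asym)
qed

lemma distinguished_schur_labeling: "distinguished n \<tau> \<Longrightarrow> schur_labeling n \<tau>"
  unfolding schur_labeling_def distinguished_def by fastforce

text \<open>A label that violates regularity for the pair \<open>x\<close>, \<open>z\<close> sits on a box incomparable to both, and
  then lies on the same side, south-west or north-east, of both; its label is too large or too
  small.\<close>
lemma distinguished_regular:
  assumes d: "distinguished n \<tau>"
  shows "regular n (poset \<tau>)"
  unfolding regular_def
proof (intro ballI impI)
  have t: "bijective_tableau n \<tau>" using d by (simp add: distinguished_def)
  fix x y z assume xyz: "x \<in> {1..n}" "y \<in> {1..n}" "z \<in> {1..n}"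
    and h: "(x, z) \<in> poset \<tau> \<and> (x < y \<and> y < z \<or> z < y \<and> y < x)"
  from bijective_tableauD(6)[OF t] xyz obtain a b c where
    abc: "a \<in> diagram (sh \<tau>)" "b \<in> diagram (sh \<tau>)" "c \<in> diagram (sh \<tau>)"
      "x = entry \<tau> a" "y = entry \<tau> b" "z = entry \<tau> c" by metis
  note iff = poset_entry_iff[OF t]
  have ac: "SE a c" using h abc iff by simp
  show "(x, y) \<in> poset \<tau> \<or> (y, z) \<in> poset \<tau>"
  proof (rule ccontr)
    assume "\<not> ?thesis"
    then have "\<not> SE a b" "\<not> SE b c" using abc iff by auto
    with ac have "SW a b \<and> SW c b \<or> SW b a \<and> SW b c" by (auto simp: SE_def SW_def)
    moreover have "entry \<tau> u < entry \<tau> v" if "SW u v" "u \<in> diagram (sh \<tau>)" "v \<in> diagram (sh \<tau>)" for u v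
      using distinguished_SW_iff[OF d that(2,3)] that by blast
    ultimately show False using h abc by (meson less_asym)
  qed
qed

text \<open>A box in the top row of the upper component lies strictly to the north-east of a box of the
  lower one, hence so does every box of the upper component with respect to every box of the lower.\<close>
lemma distinguished_components_ordered:
  assumes d: "distinguished n \<tau>"
  shows "components_ordered \<tau>"
  unfolding components_ordered_def
proof (intro ballI impI)
  let ?D = "diagram (sh \<tau>)"
  have t: "bijective_tableau n \<tau>" using d by (simp add: distinguished_def)
  note cv = bijective_tableauD(2)[OF t]
  fix A B assume "A \<in> components ?D" "B \<in> components ?D" and lt: "Min (fst ` A) < Min (fst ` B)"
  then obtain a b where ab: "a \<in> ?D" "b \<in> ?D" "A = conn ?D `` {a}" "B = conn ?D `` {b}"
    unfolding components_def quotient_def by blast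
  have cA: "(a, x) \<in> conn ?D" if "x \<in> A" for x using that ab(3) by simp
  have cB: "(b, x) \<in> conn ?D" if "x \<in> B" for x using that ab(4) by simp
  have sub: "A \<subseteq> ?D" "B \<subseteq> ?D"
    using conn_closed[OF cA ab(1)] conn_closed[OF cB ab(2)] by blast+
  then have fin: "finite A" "finite B" using bijective_tableauD(3)[OF t] finite_subset by auto
  have ne: "a \<in> A" "b \<in> B" using ab by auto
  have "Min (fst ` A) \<in> fst ` A" using fin ne by (intro Min_in) auto
  then obtain a0 where a0: "a0 \<in> A" "fst a0 = Min (fst ` A)" by (metis imageE)
  have nconn: "(a, b) \<notin> conn ?D"
  proof
    assume "(a, b) \<in> conn ?D"
    then have "conn ?D `` {a} = conn ?D `` {b}"
      by (rule conn_class_eq)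
    then have "A = B" using ab by simp
    then show False using lt by simp
  qed
  have nc: "(x, y) \<notin> conn ?D" if "x \<in> A" "y \<in> B" for x y
    using rtrancl_trans[OF rtrancl_trans[OF cA[OF that(1)]] conn_sym[OF cB[OF that(2)]]] nconn by blast
  have "fst a0 < fst b" using lt a0 fin ne by (metis Min_le finite_imageI image_eqI less_le_trans)
  moreover have "\<not> SE a0 b" "\<not> SE b a0"
    using SE_imp_conn[OF cv] nc[OF a0(1) ne(2)] conn_sym a0(1) ne sub by blast+
  ultimately have "SW a0 b" by (auto simp: SE_def SW_def)
  have less: "entry \<tau> x < entry \<tau> y" if "x \<in> A" "y \<in> B" for x y
  proof -
    have "(a0, x) \<in> conn ?D" using rtrancl_trans[OF conn_sym[OF cA[OF a0(1)]] cA[OF that(1)]] .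
    moreover have "(b, y) \<in> conn ?D" using cB[OF that(2)] .
    ultimately have "SW x y" using SW_conn[OF cv] nc[OF a0(1) ne(2)] \<open>SW a0 b\<close> a0(1) ne sub by blast
    then show ?thesis using distinguished_SW_iff[OF d] that sub by blast
  qed
  have "Min (entry \<tau> ` A) \<in> entry \<tau> ` A" "Min (entry \<tau> ` B) \<in> entry \<tau> ` B"
    using fin ne by (auto intro!: Min_in)
  then obtain y where "y \<in> B" "Min (entry \<tau> ` B) = entry \<tau> y" by blast
  moreover have "Min (entry \<tau> ` A) \<le> entry \<tau> a" using fin ne by auto
  ultimately show "Min (entry \<tau> ` A) < Min (entry \<tau> ` B)" using less[OF ne(1)] by (metis order_le_less_trans)
qed

text \<open>Row and column numbers of a basic shape are initial segments of the positive integers, so it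
  is enough to recover their order from the poset.\<close>
lemma order_iso_onto_initial_segment_eq:
  fixes f g :: "'a \<Rightarrow> nat"
  assumes f: "f ` A = {1..k}" and g: "g ` A = {1..l}"
    and ord: "\<And>x y. x \<in> A \<Longrightarrow> y \<in> A \<Longrightarrow> f x < f y \<longleftrightarrow> g x < g y"
  shows "x \<in> A \<Longrightarrow> f x = g x"
proof (induction "f x" arbitrary: x rule: less_induct)
  case less
  have rng: "f x \<in> {1..k}" "g x \<in> {1..l}" using less.prems f g by auto
  show ?case
  proof (rule ccontr)
    assume "f x \<noteq> g x"
    then consider "g x < f x" | "f x < g x" by linarith
    then show False
    proof cases
      case 1
      then have "g x \<in> f ` A" using f rng by auto
      then obtain y where y: "y \<in> A" "f y = g x" by auto
      then show False using less.hyps[of y] ord[of y x] less.prems 1 by simp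
    next
      case 2
      then have "f x \<in> g ` A" using g rng by auto
      then obtain y where y: "y \<in> A" "g y = f x" by auto
      then show False using less.hyps[of y] ord[of y x] less.prems 2 by simp
    qed
  qed
qed

text \<open>The poset and the labels detect that a box lies in a higher row than another one: either
  the two are incomparable and the first has the smaller label, or the box just below the first one
  is still weakly above and to the left of the second and has a larger label than the first.
  Columns are detected in the same way by the box just to the right.\<close>
lemma distinguished_rows_cols_determined:
  assumes d: "distinguished n \<tau>" and d': "distinguished n \<tau>'" and eq: "poset \<tau> = poset \<tau>'"
    and ab: "a \<in> diagram (sh \<tau>)" "b \<in> diagram (sh \<tau>)"
    and ab': "a' \<in> diagram (sh \<tau>')" "b' \<in> diagram (sh \<tau>')"
    and e: "entry \<tau> a = entry \<tau>' a'" "entry \<tau> b = entry \<tau>' b'"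
  shows "fst a < fst b \<Longrightarrow> fst a' < fst b'" and "snd a < snd b \<Longrightarrow> snd a' < snd b'"
proof -
  have t: "bijective_tableau n \<tau>" and t': "bijective_tableau n \<tau>'" using d d' by (auto simp: distinguished_def)
  note cv = bijective_tableauD(2)[OF t]
  have SE_iff: "SE u v \<longleftrightarrow> SE u' v'"
    if "u \<in> diagram (sh \<tau>)" "v \<in> diagram (sh \<tau>)" "u' \<in> diagram (sh \<tau>')" "v' \<in> diagram (sh \<tau>')"
      "entry \<tau> u = entry \<tau>' u'" "entry \<tau> v = entry \<tau>' v'" for u v u' v'
    using poset_entry_iff[OF t that(1,2)] poset_entry_iff[OF t' that(3,4)] that(5,6) eq by simp
  have ex: "\<exists>u'\<in>diagram (sh \<tau>'). entry \<tau>' u' = entry \<tau> u" if "u \<in> diagram (sh \<tau>)" for u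
    using bijective_tableauD(6)[OF t'] bijective_tableauD(4)[OF t that] by blast
  have SW_iff: "SW a b \<longleftrightarrow> SW a' b'" "SW b a \<longleftrightarrow> SW b' a'"
    using SE_iff[OF ab ab' e] SE_iff[OF ab(2,1) ab'(2,1) e(2,1)] e
    by (simp_all only: distinguished_SW_iff[OF d] distinguished_SW_iff[OF d'] ab ab')
  show "fst a' < fst b'" if lt: "fst a < fst b"
  proof (cases "snd a \<le> snd b")
    case True
    let ?u = "(fst a + 1, snd a)"
    have u: "?u \<in> diagram (sh \<tau>)" using order_convexD[OF cv ab] lt True by simp
    then obtain u' where u': "u' \<in> diagram (sh \<tau>')" "entry \<tau>' u' = entry \<tau> ?u" using ex by blast
    have "entry \<tau> a < entry \<tau> ?u" using distinguished_less[OF d ab(1) u] by (auto simp: prod_eq_iff)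
    then have "\<not> (fst u' \<le> fst a' \<and> snd a' \<le> snd u')"
      using distinguished_less[OF d' u'(1) ab'(1)] u' e by fastforce
    moreover have "SE a' u'" using SE_iff[OF ab(1) u ab'(1) u'(1)] e u' by (auto simp: SE_def)
    moreover have "SE u' b'" using SE_iff[OF u ab(2) u'(1) ab'(2)] e u' lt True by (auto simp: SE_def)
    ultimately show ?thesis by (auto simp: SE_def)
  next
    case False
    then show ?thesis using SW_iff(1) lt by (auto simp: SW_def)
  qed
  show "snd a' < snd b'" if lt: "snd a < snd b"
  proof (cases "fst a \<le> fst b")
    case True
    let ?u = "(fst a, snd a + 1)"
    have u: "?u \<in> diagram (sh \<tau>)" using order_convexD[OF cv ab] lt True by simp
    then obtain u' where u': "u' \<in> diagram (sh \<tau>')" "entry \<tau>' u' = entry \<tau> ?u" using ex by blast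
    have "entry \<tau> ?u < entry \<tau> a" using distinguished_less[OF d u ab(1)] by (auto simp: prod_eq_iff)
    then have "\<not> (fst a' \<le> fst u' \<and> snd u' \<le> snd a')"
      using distinguished_less[OF d' ab'(1) u'(1)] u' e by fastforce
    moreover have "SE a' u'" using SE_iff[OF ab(1) u ab'(1) u'(1)] e u' by (auto simp: SE_def)
    moreover have "SE u' b'" using SE_iff[OF u ab(2) u'(1) ab'(2)] e u' lt True by (auto simp: SE_def)
    ultimately show ?thesis by (auto simp: SE_def)
  next
    case False
    then show ?thesis using SW_iff(2) lt by (auto simp: SW_def)
  qed
qed

lemma distinguished_unique:
  assumes d: "distinguished n \<tau>" and d': "distinguished n \<tau>'" and eq: "poset \<tau> = poset \<tau>'"
  shows "\<tau> = \<tau>'"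
proof -
  have t: "bijective_tableau n \<tau>" and t': "bijective_tableau n \<tau>'" using d d' by (auto simp: distinguished_def)
  define p where "p = inv_into (diagram (sh \<tau>)) (entry \<tau>)"
  define p' where "p' = inv_into (diagram (sh \<tau>')) (entry \<tau>')"
  have b: "bij_betw (entry \<tau>) (diagram (sh \<tau>)) {1..n}" "bij_betw (entry \<tau>') (diagram (sh \<tau>')) {1..n}"
    using t t' by (auto simp: bijective_tableau_def)
  have im: "p ` {1..n} = diagram (sh \<tau>)" "p' ` {1..n} = diagram (sh \<tau>')"
    using b bij_betw_inv_into bij_betw_imp_surj_on unfolding p_def p'_def by blast+
  have e: "entry \<tau> (p x) = x" "entry \<tau>' (p' x) = x" if "x \<in> {1..n}" for x
    using that b by (auto simp: p_def p'_def bij_betw_inv_into_right simp del: atLeastAtMost_iff)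
  have mem: "p x \<in> diagram (sh \<tau>)" "p' x \<in> diagram (sh \<tau>')" if "x \<in> {1..n}" for x using im that by blast+
  have rows: "fst (p x) < fst (p y) \<longleftrightarrow> fst (p' x) < fst (p' y)"
    and cols: "snd (p x) < snd (p y) \<longleftrightarrow> snd (p' x) < snd (p' y)" if "x \<in> {1..n}" "y \<in> {1..n}" for x y
  proof -
    have e': "entry \<tau> (p x) = entry \<tau>' (p' x)" "entry \<tau> (p y) = entry \<tau>' (p' y)" using e that by auto
    note m = mem(1)[OF that(1)] mem(1)[OF that(2)] mem(2)[OF that(1)] mem(2)[OF that(2)]
    note fwd = distinguished_rows_cols_determined[OF d d' eq m e']
    note bwd = distinguished_rows_cols_determined[OF d' d eq[symmetric] m(3,4,1,2) e'[symmetric]]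
    show "fst (p x) < fst (p y) \<longleftrightarrow> fst (p' x) < fst (p' y)" using fwd(1) bwd(1) by (rule iffI)
    show "snd (p x) < snd (p y) \<longleftrightarrow> snd (p' x) < snd (p' y)" using fwd(2) bwd(2) by (rule iffI)
  qed
  have rows_im: "(\<lambda>x. fst (p x)) ` {1..n} = {1..length (fst (sh \<tau>))}"
    using basic_rows[OF bijective_tableauD(1)[OF t]] unfolding im(1)[symmetric] image_image .
  have rows'_im: "(\<lambda>x. fst (p' x)) ` {1..n} = {1..length (fst (sh \<tau>'))}"
    using basic_rows[OF bijective_tableauD(1)[OF t']] unfolding im(2)[symmetric] image_image .
  have fst_eq: "fst (p x) = fst (p' x)" if "x \<in> {1..n}" for x
    by (rule order_iso_onto_initial_segment_eq[OF rows_im rows'_im rows that])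
  have cols_im: "(\<lambda>x. snd (p x)) ` {1..n} = {1..part (fst (sh \<tau>)) 1}"
    using basic_cols[OF bijective_tableauD(1)[OF t]] unfolding im(1)[symmetric] image_image .
  have cols'_im: "(\<lambda>x. snd (p' x)) ` {1..n} = {1..part (fst (sh \<tau>')) 1}"
    using basic_cols[OF bijective_tableauD(1)[OF t']] unfolding im(2)[symmetric] image_image .
  have snd_eq: "snd (p x) = snd (p' x)" if "x \<in> {1..n}" for x
    by (rule order_iso_onto_initial_segment_eq[OF cols_im cols'_im cols that])
  have pp: "p x = p' x" if "x \<in> {1..n}" for x using fst_eq[OF that] snd_eq[OF that] by (rule prod_eqI)
  then have "p ` {1..n} = p' ` {1..n}" by (intro image_cong) auto
  then have D: "diagram (sh \<tau>) = diagram (sh \<tau>')" using im by simp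
  have "entry \<tau> a = entry \<tau>' a" if "a \<in> diagram (sh \<tau>)" for a
  proof -
    obtain x where "x \<in> {1..n}" "a = p x" using \<open>a \<in> diagram (sh \<tau>)\<close> im by blast
    then show ?thesis using e pp by metis
  qed
  then have "entry \<tau> = entry \<tau>'"
    using t t' D unfolding bijective_tableau_def by (metis extensionalityI)
  moreover have "sh \<tau> = sh \<tau>'"
    using basic_diagram_inject[OF _ _ D] bijective_tableauD(1) t t' by blast
  ultimately show ?thesis by (auto simp: sh_def entry_def intro: prod_eqI)
qed

section \<open>Distinguished labelings of regular Schur labeled posets\<close>

text \<open>Inside a component the Schur condition alone makes labels increase to the south-west: one can
  travel from \<open>a\<close> to \<open>b\<close> using only steps to the left and steps down, and the label increases at each
  of them. The path moves to the left only as far as the next row forces it to, so it enters row \<open>k\<close> at the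
  last box of that row that is not to the right of \<open>a\<close>.\<close>
lemma schur_labeling_le_in_component:
  assumes s: "schur_labeling n \<tau>" and c: "(a, b) \<in> conn (diagram (sh \<tau>))"
    and a: "a \<in> diagram (sh \<tau>)" and b: "b \<in> diagram (sh \<tau>)"
    and le: "fst a \<le> fst b" "snd b \<le> snd a"
  shows "entry \<tau> a \<le> entry \<tau> b"
proof -
  let ?D = "diagram (sh \<tau>)"
  define la mu where "la = part (fst (sh \<tau>))" and "mu = part (snd (sh \<tau>))"
  have sk: "is_skew (sh \<tau>)" using s by (auto simp: schur_labeling_def bijective_tableau_def basic_def)
  have D: "(i, j) \<in> ?D \<longleftrightarrow> 1 \<le> i \<and> mu i < j \<and> j \<le> la i" for i j
    by (auto simp: diagram_def la_def mu_def)
  have anti: "la (k + 1) \<le> la k" "mu (k + 1) \<le> mu k" if "1 \<le> k" for k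
    using sk that by (auto simp: is_skew_def la_def mu_def intro!: part_antimono)
  have row: "entry \<tau> (i, j') \<le> entry \<tau> (i, j)" if "(i, j) \<in> ?D" "(i, j') \<in> ?D" "j \<le> j'" for i j j'
    using s that unfolding schur_labeling_def by (cases "j = j'") (auto simp: less_imp_le)
  have col: "entry \<tau> (i, j) \<le> entry \<tau> (i + 1, j)" if "(i, j) \<in> ?D" "(i + 1, j) \<in> ?D" for i j
    using s that unfolding schur_labeling_def by (auto simp: less_imp_le)
  have a1: "1 \<le> fst a" "mu (fst a) < snd a" "snd a \<le> la (fst a)" using a D[of "fst a" "snd a"] by auto
  \<comment> \<open>consecutive rows met on the way share a column, else no path could cross between them\<close>
  have overlap: "mu r < la (r + 1)" if r: "fst a \<le> r" "r < fst b" for r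
  proof (rule ccontr)
    assume no: "\<not> mu r < la (r + 1)"
    have "fst x \<le> r" if "(a, x) \<in> conn ?D" for x
      using that
    proof (induction rule: rtrancl_induct)
      case (step x y)
      show ?case
      proof (rule ccontr)
        assume "\<not> fst y \<le> r"
        then have "fst x = r" "fst y = r + 1" "snd x = snd y"
          using step by (auto simp: share_edge_def)
        then have "(r, snd x) \<in> ?D" "(r + 1, snd x) \<in> ?D"
          using step(2) by (metis (no_types, lifting) case_prodD mem_Collect_eq prod.collapse)+
        then show False using no D by auto
      qed
    qed (use r in simp)
    from this[OF c] show False using r by simp
  qed
  have "(k, min (snd a) (la k)) \<in> ?D \<and> entry \<tau> a \<le> entry \<tau> (k, min (snd a) (la k))"
    if "fst a \<le> k" "k \<le> fst b" for k
    using that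
  proof (induction k rule: dec_induct)
    case base
    then show ?case using a1 a by (simp add: min_absorb1)
  next
    case (step k)
    let ?c = "min (snd a) (la k)" and ?c' = "min (snd a) (la (k + 1))"
    have k1: "1 \<le> k" using a1 step by simp
    have IH: "(k, ?c) \<in> ?D" "entry \<tau> a \<le> entry \<tau> (k, ?c)" using step by auto
    have "mu k < la (k + 1)" using overlap[of k] step by simp
    then have in': "(k, ?c') \<in> ?D" "(k + 1, ?c') \<in> ?D" and "?c' \<le> ?c"
      using IH(1) anti[OF k1] k1 by (auto simp: D)
    then have "entry \<tau> (k, ?c) \<le> entry \<tau> (k, ?c')" "entry \<tau> (k, ?c') \<le> entry \<tau> (k + 1, ?c')"
      using row[OF in'(1) IH(1)] col[OF in'] by auto
    then show ?case using in' IH by simp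
  qed
  from this[of "fst b"] have "(fst b, min (snd a) (la (fst b))) \<in> ?D"
    and le': "entry \<tau> a \<le> entry \<tau> (fst b, min (snd a) (la (fst b)))" using le by auto
  moreover have "snd b \<le> min (snd a) (la (fst b))" using b le D[of "fst b" "snd b"] by simp
  ultimately have "entry \<tau> (fst b, min (snd a) (la (fst b))) \<le> entry \<tau> (fst b, snd b)"
    using row[of "fst b" "snd b"] b by simp
  then show ?thesis using le' by simp
qed

text \<open>Adjacent boxes of a component carry comparable labels, so by regularity no label of another
  component lies between them.\<close>
lemma regular_conn_less:
  assumes t: "bijective_tableau n \<tau>" and reg: "regular n (poset \<tau>)"
    and c: "(a, a') \<in> conn (diagram (sh \<tau>))" and nc: "(a, b) \<notin> conn (diagram (sh \<tau>))"
    and a: "a \<in> diagram (sh \<tau>)" and b: "b \<in> diagram (sh \<tau>)" and lt: "entry \<tau> a < entry \<tau> b"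
  shows "entry \<tau> a' < entry \<tau> b"
  using c
proof (induction rule: rtrancl_induct)
  case (step x y)
  let ?D = "diagram (sh \<tau>)"
  note cv = bijective_tableauD(2)[OF t]
  note iff = poset_entry_iff[OF t]
  have xy: "x \<in> ?D" "y \<in> ?D" "share_edge x y" using step(2) by auto
  have ay: "(a, y) \<in> conn ?D" using step(1,2) by (rule rtrancl_into_rtrancl)
  have "\<not> SE x b \<and> \<not> SE b x"
    using SE_imp_conn[OF cv xy(1) b] SE_imp_conn[OF cv b xy(1)] nc rtrancl_trans[OF step(1)] conn_sym by blast
  moreover have "\<not> SE y b \<and> \<not> SE b y"
    using SE_imp_conn[OF cv xy(2) b] SE_imp_conn[OF cv b xy(2)] nc rtrancl_trans[OF ay] conn_sym by blast
  ultimately have nP: "(entry \<tau> x, entry \<tau> b) \<notin> poset \<tau>" "(entry \<tau> b, entry \<tau> x) \<notin> poset \<tau>"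
    "(entry \<tau> y, entry \<tau> b) \<notin> poset \<tau>" "(entry \<tau> b, entry \<tau> y) \<notin> poset \<tau>"
    using iff xy b by auto
  have P: "(entry \<tau> x, entry \<tau> y) \<in> poset \<tau> \<or> (entry \<tau> y, entry \<tau> x) \<in> poset \<tau>"
    using share_edge_SE[OF xy(3)] iff xy by auto
  have "y \<noteq> b" using ay nc by auto
  then have "entry \<tau> y \<noteq> entry \<tau> b" using bijective_tableauD(5)[OF t] xy b by simp
  moreover have "\<not> entry \<tau> b < entry \<tau> y"
    using P nP reg step.IH bijective_tableauD(4)[OF t] xy b unfolding regular_def by blast
  ultimately show ?case by simp
qed (rule lt)

text \<open>Consequently all labels of one component are smaller than all labels of the other.\<close>
lemma regular_components_separated:
  assumes t: "bijective_tableau n \<tau>" and reg: "regular n (poset \<tau>)"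
    and ca: "(a, a') \<in> conn (diagram (sh \<tau>))" and cb: "(b, b') \<in> conn (diagram (sh \<tau>))"
    and nc: "(a, b) \<notin> conn (diagram (sh \<tau>))"
    and a: "a \<in> diagram (sh \<tau>)" and b: "b \<in> diagram (sh \<tau>)" and lt: "entry \<tau> a < entry \<tau> b"
  shows "entry \<tau> a' < entry \<tau> b'"
proof (rule ccontr)
  assume no: "\<not> entry \<tau> a' < entry \<tau> b'"
  have mem: "a' \<in> diagram (sh \<tau>)" "b' \<in> diagram (sh \<tau>)"
    using conn_closed[OF ca a] conn_closed[OF cb b] .
  have nc': "(b', a') \<notin> conn (diagram (sh \<tau>))"
    using nc rtrancl_trans[OF rtrancl_trans[OF ca conn_sym] conn_sym[OF cb]] by blast
  then have "a' \<noteq> b'" by auto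
  then have "entry \<tau> b' < entry \<tau> a'" using no bijective_tableauD(5)[OF t mem] by simp
  then have "entry \<tau> b < entry \<tau> a'" using regular_conn_less[OF t reg conn_sym[OF cb] nc' mem(2,1)] by simp
  moreover have "entry \<tau> a' < entry \<tau> b" using regular_conn_less[OF t reg ca nc a b lt] .
  ultimately show False by simp
qed

text \<open>Boxes of one component are compared by the path argument. For boxes of different components, the
  order of the components by their top rows agrees with their south-west order, and the order of
  their least labels decides the order of all their labels.\<close>
lemma components_ordered_regular_distinguished:
  assumes s: "schur_labeling n \<tau>" and co: "components_ordered \<tau>" and reg: "regular n (poset \<tau>)"
  shows "distinguished n \<tau>"
  unfolding distinguished_def
proof (intro conjI ballI impI)
  show t: "bijective_tableau n \<tau>" using s by (simp add: schur_labeling_def)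
  let ?D = "diagram (sh \<tau>)"
  note cv = bijective_tableauD(2)[OF t]
  fix a b assume ab: "a \<in> ?D" "b \<in> ?D" and le: "fst a \<le> fst b \<and> snd b \<le> snd a \<and> a \<noteq> b"
  show "entry \<tau> a < entry \<tau> b"
  proof (cases "(a, b) \<in> conn ?D")
    case True
    then have "entry \<tau> a \<le> entry \<tau> b" using schur_labeling_le_in_component[OF s] ab le by blast
    then show ?thesis using bijective_tableauD(5)[OF t ab] le by simp
  next
    case False
    define A B where "A = conn ?D `` {a}" and "B = conn ?D `` {b}"
    have sub: "A \<subseteq> ?D" "B \<subseteq> ?D" unfolding A_def B_def using conn_closed ab by blast+
    then have fin: "finite A" "finite B" using bijective_tableauD(3)[OF t] finite_subset by blast+
    have ne: "a \<in> A" "b \<in> B" by (auto simp: A_def B_def)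
    have "\<not> SE a b" "\<not> SE b a" using False SE_imp_conn[OF cv] ab conn_sym by blast+
    then have "SW a b" using le by (auto simp: SE_def SW_def)
    have "Min (fst ` B) \<in> fst ` B" "Min (entry \<tau> ` A) \<in> entry \<tau> ` A" "Min (entry \<tau> ` B) \<in> entry \<tau> ` B"
      using fin ne Min_in[of "fst ` B"] Min_in[of "entry \<tau> ` A"] Min_in[of "entry \<tau> ` B"] by blast+
    then obtain y a0 b0 where y: "y \<in> B" "Min (fst ` B) = fst y"
      and a0: "a0 \<in> A" "Min (entry \<tau> ` A) = entry \<tau> a0"
      and b0: "b0 \<in> B" "Min (entry \<tau> ` B) = entry \<tau> b0" by (elim imageE) simp
    have "SW a y" using SW_conn_right[OF cv _ False ab \<open>SW a b\<close>] y(1) by (simp add: B_def)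
    moreover have "Min (fst ` A) \<le> fst a" using fin ne by simp
    ultimately have "Min (fst ` A) < Min (fst ` B)" using y by (simp add: SW_def)
    moreover have "A \<in> components ?D" "B \<in> components ?D"
      using ab unfolding A_def B_def components_def quotient_def by blast+
    ultimately have "Min (entry \<tau> ` A) < Min (entry \<tau> ` B)" using co unfolding components_ordered_def by blast
    then have lt: "entry \<tau> a0 < entry \<tau> b0" using a0(2) b0(2) by simp
    have c: "(a, a0) \<in> conn ?D" "(b, b0) \<in> conn ?D" using a0 b0 by (simp_all add: A_def B_def)
    then have "(a0, b0) \<notin> conn ?D" using False rtrancl_trans[OF rtrancl_trans[OF c(1)] conn_sym[OF c(2)]] by blast
    then show ?thesis
      using regular_components_separated[OF t reg conn_sym[OF c(1)] conn_sym[OF c(2)]] a0 b0 sub lt by blast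
  qed
qed

text \<open>Shifting each component far down and to the left, by an amount that grows with its least
  label, orders the components from the top by their labels; closing the gaps then gives a basic
  shape.\<close>
lemma exists_distinguished_of_regular:
  assumes s: "schur_labeling n \<tau>" and reg: "regular n (poset \<tau>)"
  shows "\<exists>\<tau>'. distinguished n \<tau>' \<and> poset \<tau>' = poset \<tau>"
proof -
  let ?D = "diagram (sh \<tau>)"
  have t: "bijective_tableau n \<tau>" using s by (simp add: schur_labeling_def)
  note cv = bijective_tableauD(2)[OF t] and fin = bijective_tableauD(3)[OF t]
  define m where "m a = Min (entry \<tau> ` (conn ?D `` {a}))" for a
  have m_attained: "\<exists>x. (a, x) \<in> conn ?D \<and> x \<in> ?D \<and> m a = entry \<tau> x" if a: "a \<in> ?D" for a
  proof -
    have "conn ?D `` {a} \<subseteq> ?D" using conn_closed a by blast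
    then have "finite (conn ?D `` {a})" using fin finite_subset by blast
    then have "m a \<in> entry \<tau> ` (conn ?D `` {a})" unfolding m_def by (intro Min_in) auto
    then obtain x where "(a, x) \<in> conn ?D" "m a = entry \<tau> x" unfolding Image_singleton_iff by (elim imageE) simp
    then show ?thesis using conn_closed[OF _ a] by blast
  qed
  have m_conn: "m a = m b" if "(a, b) \<in> conn ?D" for a b
    unfolding m_def conn_class_eq[OF that] ..
  have m_eq: "(a, b) \<in> conn ?D" if "m a = m b" and a: "a \<in> ?D" and b: "b \<in> ?D" for a b
  proof -
    obtain x y where x: "(a, x) \<in> conn ?D" "x \<in> ?D" "m a = entry \<tau> x"
      and y: "(b, y) \<in> conn ?D" "y \<in> ?D" "m b = entry \<tau> y" using m_attained[OF a] m_attained[OF b] by blast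
    have "x = y" using bijective_tableauD(5)[OF t x(2) y(2)] x y \<open>m a = m b\<close> by simp
    then show ?thesis using rtrancl_trans[OF x(1) conn_sym[OF y(1)[folded \<open>x = y\<close>]]] by blast
  qed
  have m_less: "entry \<tau> a < entry \<tau> b" if lt: "m a < m b" and a: "a \<in> ?D" and b: "b \<in> ?D" for a b
  proof -
    obtain x y where x: "(a, x) \<in> conn ?D" "x \<in> ?D" "m a = entry \<tau> x"
      and y: "(b, y) \<in> conn ?D" "y \<in> ?D" "m b = entry \<tau> y" using m_attained[OF a] m_attained[OF b] by blast
    have "(x, y) \<notin> conn ?D" using m_conn[OF x(1)] m_conn[OF y(1)] m_conn[of x y] lt by (metis less_irrefl)
    then show ?thesis
      using regular_components_separated[OF t reg conn_sym[OF x(1)] conn_sym[OF y(1)]] x y lt by simp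
  qed
  have m_le: "m a \<le> n" if "a \<in> ?D" for a
    using m_attained[OF that] bijective_tableauD(4)[OF t] by fastforce
  obtain N where N: "fst a < N \<and> snd a < N" if "a \<in> ?D" for a
    using diagram_bounded[OF t] by blast
  \<comment> \<open>\<open>N\<close> exceeds all coordinates, so different values of \<open>m\<close> give strict south-west position\<close>
  define p where "p a = (fst a + N * m a, snd a + N * (n - m a))" for a
  have apart: "SW (p a) (p b)" if "m a < m b" "a \<in> ?D" "b \<in> ?D" for a b
  proof -
    have "N * (m a + 1) \<le> N * m b" using that(1) by (intro mult_le_mono2) simp
    then have 1: "fst a + N * m a < fst b + N * m b" using N[OF that(2)] by simp
    have "N * (n - m b + 1) \<le> N * (n - m a)" using that(1) m_le[OF that(3)] by (intro mult_le_mono2) simp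
    then have "snd b + N * (n - m b) < snd a + N * (n - m a)" using N[OF that(3)] by simp
    then show ?thesis using 1 by (simp add: SW_def p_def)
  qed
  have SE_p: "SE (p a) (p b) \<longleftrightarrow> SE a b" if ab: "a \<in> ?D" "b \<in> ?D" for a b
  proof (cases "m a = m b")
    case True
    then show ?thesis by (simp add: SE_def p_def)
  next
    case False
    then have "\<not> SE a b" using m_conn SE_imp_conn[OF cv ab] by blast
    moreover have "\<not> SE (p a) (p b)"
      using False apart[OF _ ab] apart[OF _ ab(2,1)] by (fastforce simp: SE_def SW_def)
    ultimately show ?thesis by simp
  qed
  have SW_p: "entry \<tau> a < entry \<tau> b"
    if ab: "a \<in> ?D" "b \<in> ?D" and ne: "a \<noteq> b" and le: "fst (p a) \<le> fst (p b)" "snd (p b) \<le> snd (p a)" for a b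
  proof -
    consider "m a = m b" | "m a < m b" | "m b < m a" by linarith
    then show ?thesis
    proof cases
      case 1
      then have "entry \<tau> a \<le> entry \<tau> b"
        using schur_labeling_le_in_component[OF s m_eq[OF 1 ab] ab] le by (simp add: p_def)
      then show ?thesis using bijective_tableauD(5)[OF t ab] ne by simp
    next
      case 3
      then show ?thesis using apart[OF 3 ab(2,1)] le by (simp add: SW_def)
    qed (use m_less ab in blast)
  qed
  have "order_convex (p ` ?D)"
    unfolding order_convex_def
  proof (intro ballI allI impI)
    fix pa pb i j assume "pa \<in> p ` ?D" "pb \<in> p ` ?D"
      and ij: "fst pa \<le> i \<and> i \<le> fst pb \<and> snd pa \<le> j \<and> j \<le> snd pb"
    then obtain a b where ab: "a \<in> ?D" "b \<in> ?D" "pa = p a" "pb = p b" by blast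
    then have "SE (p a) (p b)" using ij by (auto simp: SE_def)
    then have "SE a b" using SE_p ab by blast
    then have m: "m a = m b" using m_conn SE_imp_conn[OF cv] ab by blast
    let ?c = "(i - N * m a, j - N * (n - m a))"
    have c: "?c \<in> ?D" "SE a ?c" using ij ab m order_convexD[OF cv ab(1,2)] by (auto simp: p_def SE_def)
    then have "m ?c = m a" using m_conn[OF SE_imp_conn[OF cv ab(1) c]] by simp
    then have "p ?c = (i, j)" using ij ab by (simp add: p_def)
    then show "(i, j) \<in> p ` ?D" using c(1) by (metis imageI)
  qed
  then obtain S where S: "basic S"
    "diagram S = map_prod (rank_in (fst ` p ` ?D)) (rank_in (snd ` p ` ?D)) ` p ` ?D"
    using exists_basic_compression fin by blast
  define q where "q a = map_prod (rank_in (fst ` p ` ?D)) (rank_in (snd ` p ` ?D)) (p a)" for a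
  have qD: "diagram S = q ` ?D" using S(2) by (simp add: q_def image_image)
  have q_le: "fst (q a) \<le> fst (q b) \<longleftrightarrow> fst (p a) \<le> fst (p b)" "snd (q a) \<le> snd (q b) \<longleftrightarrow> snd (p a) \<le> snd (p b)"
    if "a \<in> ?D" "b \<in> ?D" for a b
    using that fin by (auto simp: q_def rank_in_le_iff)
  have SE_q: "SE (q a) (q b) \<longleftrightarrow> SE a b" if "a \<in> ?D" "b \<in> ?D" for a b
    using q_le[OF that] SE_p[OF that] by (simp add: SE_def)
  have inj: "inj_on q ?D"
  proof (rule inj_onI)
    fix a b assume "a \<in> ?D" "b \<in> ?D" "q a = q b"
    then have "SE a b" "SE b a" using SE_q[of a b] SE_q[of b a] by (auto simp: SE_def)
    then show "a = b" by (auto simp: SE_def prod_eq_iff)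
  qed
  define \<tau>' where "\<tau>' = (S, restrict (entry \<tau> \<circ> inv_into ?D q) (diagram S))"
  have sh': "sh \<tau>' = S" by (simp add: \<tau>'_def sh_def)
  have ent: "entry \<tau>' (q a) = entry \<tau> a" if "a \<in> ?D" for a
    using that inj qD by (simp add: \<tau>'_def entry_def)
  have "bij_betw (entry \<tau>') (diagram S) {1..n}"
  proof -
    have "bij_betw (entry \<tau>' \<circ> q) ?D {1..n}"
      using t ent by (simp add: bijective_tableau_def cong: bij_betw_cong)
    then show ?thesis using bij_betw_comp_iff[of q ?D "diagram S"] inj qD by (simp add: bij_betw_def comp_inj_on_iff image_comp)
  qed
  moreover have "entry \<tau>' \<in> extensional (diagram S)" by (simp add: \<tau>'_def entry_def)
  ultimately have t': "bijective_tableau n \<tau>'" using S(1) by (simp add: bijective_tableau_def sh')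
  have "distinguished n \<tau>'"
    unfolding distinguished_def sh' qD using t' SW_p q_le by (auto simp: ent)
  moreover have "poset \<tau>' = poset \<tau>"
  proof -
    have "poset \<tau>' = {(entry \<tau>' (q a), entry \<tau>' (q b)) | a b. a \<in> ?D \<and> b \<in> ?D \<and> SE (q a) (q b)}"
      unfolding poset_def sh' qD SE_def by blast
    also have "\<dots> = {(entry \<tau> a, entry \<tau> b) | a b. a \<in> ?D \<and> b \<in> ?D \<and> SE a b}"
      using ent SE_q by (metis (no_types, lifting))
    also have "\<dots> = poset \<tau>" by (simp add: poset_def SE_def)
    finally show ?thesis .
  qed
  ultimately show ?thesis by blast
qed

lemma RSP_iff: "P \<in> RSP n \<longleftrightarrow> (\<exists>\<tau>. distinguished n \<tau> \<and> poset \<tau> = P)"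
proof
  assume "P \<in> RSP n"
  then obtain \<tau> where "schur_labeling n \<tau>" "P = poset \<tau>" "regular n (poset \<tau>)"
    unfolding RSP_def SP_def by blast
  then show "\<exists>\<tau>. distinguished n \<tau> \<and> poset \<tau> = P"
    using exists_distinguished_of_regular by blast
next
  assume "\<exists>\<tau>. distinguished n \<tau> \<and> poset \<tau> = P"
  then show "P \<in> RSP n"
    unfolding RSP_def SP_def using distinguished_schur_labeling distinguished_regular by blast
qed

lemma tau_poset:
  assumes d: "distinguished n \<tau>"
  shows "tau n (poset \<tau>) = \<tau>"
  unfolding tau_def
proof (rule the_equality)
  show "schur_labeling n \<tau> \<and> poset \<tau> = poset \<tau> \<and> components_ordered \<tau>"
    using d distinguished_schur_labeling distinguished_components_ordered by blast
next
  fix \<tau>' assume "schur_labeling n \<tau>' \<and> poset \<tau>' = poset \<tau> \<and> components_ordered \<tau>'"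
  then show "\<tau>' = \<tau>"
    using components_ordered_regular_distinguished[of n \<tau>'] distinguished_regular[OF d] distinguished_unique[OF _ d]
    by simp
qed

section \<open>Linear extensions of a distinguished poset\<close>

lemma Sigma_L_iff:
  assumes t: "bijective_tableau n \<tau>"
  shows "\<gamma> \<in> Sigma_L n (poset \<tau>) \<longleftrightarrow> \<gamma> \<in> Sym n \<and>
    (\<forall>a\<in>diagram (sh \<tau>). \<forall>b\<in>diagram (sh \<tau>). SE a b \<longrightarrow> \<gamma> (entry \<tau> a) \<le> \<gamma> (entry \<tau> b))"
  unfolding Sigma_L_def poset_def SE_def by blast

lemma Sigma_L_less:
  assumes t: "bijective_tableau n \<tau>" and g: "\<gamma> \<in> Sigma_L n (poset \<tau>)"
    and ab: "a \<in> diagram (sh \<tau>)" "b \<in> diagram (sh \<tau>)" "SE a b" "a \<noteq> b"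
  shows "\<gamma> (entry \<tau> a) < \<gamma> (entry \<tau> b)"
proof -
  have "\<gamma> (entry \<tau> a) \<le> \<gamma> (entry \<tau> b)" "\<gamma> \<in> Sym n" using g ab unfolding Sigma_L_iff[OF t] by blast+
  moreover have "entry \<tau> a \<noteq> entry \<tau> b" using bijective_tableauD(5)[OF t ab(1,2)] ab(4) by blast
  ultimately show ?thesis by (simp add: le_less)
qed

lemma exists_Sym_of_bij_betw:
  assumes "bij_betw f {1..n} {1..n}"
  shows "\<exists>\<sigma>\<in>Sym n. \<forall>x\<in>{1..n}. \<sigma> x = f x"
proof -
  let ?s = "\<lambda>x. if x \<in> {1..n} then f x else x"
  have "bij_betw ?s {1..n} {1..n}" by (subst bij_betw_cong[where g = f]) (use assms in auto)
  then have "?s permutes {1..n}" by (rule bij_imp_permutes) auto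
  then show ?thesis by (intro bexI[of _ ?s]) (auto simp: Sym_def)
qed

lemma exists_Sym_of_key:
  assumes t: "bijective_tableau n \<tau>" and inj: "inj_on k (diagram (sh \<tau>))"
  shows "\<exists>\<sigma>\<in>Sym n. \<forall>a\<in>diagram (sh \<tau>). \<forall>b\<in>diagram (sh \<tau>).
    \<sigma> (entry \<tau> a) < \<sigma> (entry \<tau> b) \<longleftrightarrow> k a < (k b :: nat)"
proof -
  let ?D = "diagram (sh \<tau>)"
  have fin: "finite (k ` ?D)" using bijective_tableauD(3)[OF t] by simp
  have b: "bij_betw (entry \<tau>) ?D {1..n}" using t by (simp add: bijective_tableau_def)
  have "card (k ` ?D) = n" using card_image[OF inj] bij_betw_same_card[OF b] by simp
  then have "bij_betw (rank_in (k ` ?D)) (k ` ?D) {1..n}" using bij_betw_rank_in[OF fin] by simp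
  then have "bij_betw (rank_in (k ` ?D) \<circ> (k \<circ> inv_into ?D (entry \<tau>))) {1..n} {1..n}"
    using bij_betw_inv_into[OF b] inj by (intro bij_betw_trans) (auto intro: inj_on_imp_bij_betw)
  then obtain \<sigma> where \<sigma>: "\<sigma> \<in> Sym n" "\<forall>x\<in>{1..n}. \<sigma> x = rank_in (k ` ?D) (k (inv_into ?D (entry \<tau>) x))"
    using exists_Sym_of_bij_betw by fastforce
  have "\<sigma> (entry \<tau> a) = rank_in (k ` ?D) (k a)" if "a \<in> ?D" for a
    using \<sigma>(2) bijective_tableauD(4)[OF t that] bij_betw_inv_into_left[OF b that] by simp
  then show ?thesis using \<sigma>(1) fin by (intro bexI[of _ \<sigma>]) (simp_all add: rank_in_less_iff)
qed

lemma lexicographic_key: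
  fixes p q p' q' N :: nat
  assumes "q < N" "q' < N"
  shows "p * N + q < p' * N + q' \<longleftrightarrow> p < p' \<or> p = p' \<and> q < q'"
proof -
  consider "p < p'" | "p = p'" | "p' < p" by linarith
  then show ?thesis
  proof cases
    case 1
    then have "(p + 1) * N \<le> p' * N" by (intro mult_le_mono1) simp
    then show ?thesis using 1 assms by simp
  next
    case 3
    then have "(p' + 1) * N \<le> p * N" by (intro mult_le_mono1) simp
    then show ?thesis using 3 assms by simp
  qed simp
qed

lemma exists_lexicographic_reading:
  assumes t: "bijective_tableau n \<tau>" and N: "\<And>a. a \<in> diagram (sh \<tau>) \<Longrightarrow> q a < (N :: nat)"
    and eq: "\<And>a b. p a = p b \<Longrightarrow> q a = q b \<Longrightarrow> a = b"
  shows "\<exists>\<sigma>\<in>Sym n. \<forall>a\<in>diagram (sh \<tau>). \<forall>b\<in>diagram (sh \<tau>).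
    \<sigma> (entry \<tau> a) < \<sigma> (entry \<tau> b) \<longleftrightarrow> p a < (p b :: nat) \<or> p a = p b \<and> q a < q b"
proof -
  have lex: "p a * N + q a < p b * N + q b \<longleftrightarrow> p a < p b \<or> p a = p b \<and> q a < q b"
    if "a \<in> diagram (sh \<tau>)" "b \<in> diagram (sh \<tau>)" for a b
    using N[OF that(1)] N[OF that(2)] by (rule lexicographic_key)
  have "inj_on (\<lambda>a. p a * N + q a) (diagram (sh \<tau>))"
  proof (rule inj_onI)
    fix a b assume "a \<in> diagram (sh \<tau>)" "b \<in> diagram (sh \<tau>)" "p a * N + q a = p b * N + q b"
    then have "p a = p b" "q a = q b" using lex[of a b] lex[of b a] by auto
    then show "a = b" by (rule eq)
  qed
  from exists_Sym_of_key[OF t this] show ?thesis using lex by simp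
qed

lemma exists_row_reading:
  assumes t: "bijective_tableau n \<tau>"
  shows "\<exists>\<sigma>\<in>Sym n. \<forall>a\<in>diagram (sh \<tau>). \<forall>b\<in>diagram (sh \<tau>).
    \<sigma> (entry \<tau> a) < \<sigma> (entry \<tau> b) \<longleftrightarrow> fst a < fst b \<or> fst a = fst b \<and> snd a < snd b"
proof -
  obtain N where "\<And>a. a \<in> diagram (sh \<tau>) \<Longrightarrow> fst a < N \<and> snd a < N" using diagram_bounded[OF t] by blast
  then show ?thesis by (intro exists_lexicographic_reading[OF t, of snd N fst]) (simp_all add: prod_eq_iff)
qed

lemma exists_column_reading:
  assumes t: "bijective_tableau n \<tau>"
  shows "\<exists>\<sigma>\<in>Sym n. \<forall>a\<in>diagram (sh \<tau>). \<forall>b\<in>diagram (sh \<tau>).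
    \<sigma> (entry \<tau> a) < \<sigma> (entry \<tau> b) \<longleftrightarrow> snd a < snd b \<or> snd a = snd b \<and> fst a < fst b"
proof -
  obtain N where "\<And>a. a \<in> diagram (sh \<tau>) \<Longrightarrow> fst a < N \<and> snd a < N" using diagram_bounded[OF t] by blast
  then show ?thesis by (intro exists_lexicographic_reading[OF t, of fst N snd]) (simp_all add: prod_eq_iff)
qed

lemma Inv_entry_iff:
  assumes t: "bijective_tableau n \<tau>" and "a \<in> diagram (sh \<tau>)" "b \<in> diagram (sh \<tau>)"
  shows "(entry \<tau> a, entry \<tau> b) \<in> Inv n \<gamma> \<longleftrightarrow> entry \<tau> a < entry \<tau> b \<and> \<gamma> (entry \<tau> b) < \<gamma> (entry \<tau> a)"
  using bijective_tableauD(4)[OF t assms(2)] bijective_tableauD(4)[OF t assms(3)] by (auto simp: Inv_def)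

lemma Inv_subset_iff:
  assumes t: "bijective_tableau n \<tau>"
  shows "Inv n \<gamma> \<subseteq> Inv n \<delta> \<longleftrightarrow> (\<forall>a\<in>diagram (sh \<tau>). \<forall>b\<in>diagram (sh \<tau>).
    entry \<tau> a < entry \<tau> b \<and> \<gamma> (entry \<tau> b) < \<gamma> (entry \<tau> a) \<longrightarrow> \<delta> (entry \<tau> b) < \<delta> (entry \<tau> a))"
    (is "?L = ?R")
proof
  assume ?L then show ?R using Inv_entry_iff[OF t] by blast
next
  assume R: ?R
  show ?L
  proof (rule subrelI)
    fix x y assume xy: "(x, y) \<in> Inv n \<gamma>"
    then have "x \<in> {1..n}" "y \<in> {1..n}" by (auto simp: Inv_def)
    then obtain a b where "a \<in> diagram (sh \<tau>)" "b \<in> diagram (sh \<tau>)" "entry \<tau> a = x" "entry \<tau> b = y"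
      using bijective_tableauD(6)[OF t] by blast
    then show "(x, y) \<in> Inv n \<delta>" using R xy Inv_entry_iff[OF t] by blast
  qed
qed

text \<open>The bottom of the interval reads the diagram row by row and the top reads it column by column.
  Both respect the poset. Of two boxes in south-west position the north-eastern one has the smaller
  label, and it comes first in the row reading and last in the column reading; so the bottom inverts
  none of these pairs, the top inverts all of them, and lying between the two readings constrains
  comparable boxes only.\<close>
lemma Sigma_L_is_interval:
  assumes d: "distinguished n \<tau>"
  shows "Sigma_L n (poset \<tau>) \<in> Int_L n"
proof -
  let ?D = "diagram (sh \<tau>)" and ?e = "entry \<tau>"
  have t: "bijective_tableau n \<tau>" using d by (simp add: distinguished_def)
  obtain \<sigma> where \<sigma>: "\<sigma> \<in> Sym n" "\<And>a b. a \<in> ?D \<Longrightarrow> b \<in> ?D \<Longrightarrow>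
    \<sigma> (?e a) < \<sigma> (?e b) \<longleftrightarrow> fst a < fst b \<or> fst a = fst b \<and> snd a < snd b"
    using exists_row_reading[OF t] by blast
  obtain \<rho> where \<rho>: "\<rho> \<in> Sym n" "\<And>a b. a \<in> ?D \<Longrightarrow> b \<in> ?D \<Longrightarrow>
    \<rho> (?e a) < \<rho> (?e b) \<longleftrightarrow> snd a < snd b \<or> snd a = snd b \<and> fst a < fst b"
    using exists_column_reading[OF t] by blast
  have mem_iff: "\<gamma> \<in> Sigma_L n (poset \<tau>) \<longleftrightarrow> Inv n \<sigma> \<subseteq> Inv n \<gamma> \<and> Inv n \<gamma> \<subseteq> Inv n \<rho>"
    if g: "\<gamma> \<in> Sym n" for \<gamma>
  proof
    assume S: "\<gamma> \<in> Sigma_L n (poset \<tau>)"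
    show "Inv n \<sigma> \<subseteq> Inv n \<gamma> \<and> Inv n \<gamma> \<subseteq> Inv n \<rho>"
      unfolding Inv_subset_iff[OF t]
    proof (intro conjI ballI impI)
      fix a b assume ab: "a \<in> ?D" "b \<in> ?D"
      assume h: "?e a < ?e b \<and> \<sigma> (?e b) < \<sigma> (?e a)"
      then have "\<not> (fst b \<le> fst a \<and> snd a \<le> snd b)"
        using distinguished_less[OF d ab(2,1)] by (metis less_asym less_irrefl)
      then have "SE b a" "b \<noteq> a" using h \<sigma>(2)[OF ab(2,1)] by (auto simp: SE_def)
      then show "\<gamma> (?e b) < \<gamma> (?e a)" using Sigma_L_less[OF t S ab(2,1)] by blast
    next
      fix a b assume ab: "a \<in> ?D" "b \<in> ?D"
      assume h: "?e a < ?e b \<and> \<gamma> (?e b) < \<gamma> (?e a)"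
      then have "\<not> (fst b \<le> fst a \<and> snd a \<le> snd b)"
        using distinguished_less[OF d ab(2,1)] by (metis less_asym less_irrefl)
      moreover have "\<not> SE a b" using h Sigma_L_less[OF t S ab] by (metis less_asym less_irrefl)
      ultimately show "\<rho> (?e b) < \<rho> (?e a)" using \<rho>(2)[OF ab(2,1)] by (auto simp: SE_def)
    qed
  next
    assume h: "Inv n \<sigma> \<subseteq> Inv n \<gamma> \<and> Inv n \<gamma> \<subseteq> Inv n \<rho>"
    have "\<gamma> (?e a) \<le> \<gamma> (?e b)" if ab: "a \<in> ?D" "b \<in> ?D" and SE: "SE a b" for a b
    proof (rule ccontr)
      assume "\<not> \<gamma> (?e a) \<le> \<gamma> (?e b)"
      then have gt: "\<gamma> (?e b) < \<gamma> (?e a)" and ne: "a \<noteq> b" by auto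
      consider "?e a < ?e b" | "?e b < ?e a" using bijective_tableauD(5)[OF t ab] ne by linarith
      then show False
      proof cases
        case 1
        then have "\<rho> (?e b) < \<rho> (?e a)" using h gt ab unfolding Inv_subset_iff[OF t] by blast
        then show False using \<rho>(2)[OF ab(2,1)] SE by (auto simp: SE_def)
      next
        case 2
        moreover have "\<sigma> (?e a) < \<sigma> (?e b)"
          using \<sigma>(2)[OF ab] SE ne by (auto simp: SE_def prod_eq_iff)
        ultimately have "\<gamma> (?e a) < \<gamma> (?e b)" using h ab unfolding Inv_subset_iff[OF t] by blast
        then show False using gt by simp
      qed
    qed
    then show "\<gamma> \<in> Sigma_L n (poset \<tau>)" using g unfolding Sigma_L_iff[OF t] by blast
  qed
  have "\<sigma> (?e a) \<le> \<sigma> (?e b)" if "a \<in> ?D" "b \<in> ?D" "SE a b" for a b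
    using \<sigma>(2)[of b a] that by (auto simp: SE_def not_less[symmetric])
  then have "\<sigma> \<in> Sigma_L n (poset \<tau>)" using \<sigma>(1) unfolding Sigma_L_iff[OF t] by blast
  moreover have "Sigma_L n (poset \<tau>) = weak_interval n \<sigma> \<rho>"
  proof (rule set_eqI)
    fix \<gamma>
    have "\<gamma> \<in> Sym n" if "\<gamma> \<in> Sigma_L n (poset \<tau>)" using that unfolding Sigma_L_iff[OF t] by blast
    then show "\<gamma> \<in> Sigma_L n (poset \<tau>) \<longleftrightarrow> \<gamma> \<in> weak_interval n \<sigma> \<rho>"
      unfolding weak_interval_def mem_Collect_eq weak_order_iff using mem_iff \<sigma>(1) \<rho>(1) by blast
  qed
  ultimately show ?thesis using \<sigma>(1) \<rho>(1) unfolding Int_L_def by blast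
qed

text \<open>On comparable boxes all members of the interval agree, and the incomparable pairs together with the
  order of their labels are known from the shape. Hence the weak order depends only on the
  fillings \<open>\<gamma> \<circ> entry \<tau>\<close>.\<close>
lemma Sigma_L_weak_order_iff:
  assumes d: "distinguished n \<tau>"
    and g: "\<gamma> \<in> Sigma_L n (poset \<tau>)" and h: "\<delta> \<in> Sigma_L n (poset \<tau>)"
  shows "(\<gamma>, \<delta>) \<in> weak_order n \<longleftrightarrow> (\<forall>a\<in>diagram (sh \<tau>). \<forall>b\<in>diagram (sh \<tau>).
    SW a b \<and> \<gamma> (entry \<tau> b) < \<gamma> (entry \<tau> a) \<longrightarrow> \<delta> (entry \<tau> b) < \<delta> (entry \<tau> a))"
proof -
  let ?D = "diagram (sh \<tau>)" and ?e = "entry \<tau>"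
  have t: "bijective_tableau n \<tau>" using d by (simp add: distinguished_def)
  have sym: "\<gamma> \<in> Sym n" "\<delta> \<in> Sym n" using g h unfolding Sigma_L_iff[OF t] by blast+
  have "(?e a < ?e b \<and> \<gamma> (?e b) < \<gamma> (?e a) \<longrightarrow> \<delta> (?e b) < \<delta> (?e a)) \<longleftrightarrow>
      (SW a b \<and> \<gamma> (?e b) < \<gamma> (?e a) \<longrightarrow> \<delta> (?e b) < \<delta> (?e a))"
    if ab: "a \<in> ?D" "b \<in> ?D" for a b
  proof (cases "SE a b \<or> SE b a \<or> a = b")
    case True
    then have "\<gamma> (?e b) < \<gamma> (?e a) \<Longrightarrow> \<delta> (?e b) < \<delta> (?e a)"
      using Sigma_L_less[OF t g ab] Sigma_L_less[OF t h ab(2,1)] by (metis less_asym less_irrefl)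
    then show ?thesis by blast
  next
    case False
    then show ?thesis using distinguished_SW_iff[OF d ab] by blast
  qed
  then show ?thesis unfolding weak_order_iff Inv_subset_iff[OF t] using sym by blast
qed

text \<open>Two boxes that receive consecutive values cannot be strictly south-east of each other, since the
  corner box between them would receive a value in between. In all the remaining positions the shape
  decides which of the labels is larger.\<close>
lemma Sigma_L_descent_iff:
  assumes d: "distinguished n \<tau>" and g: "\<gamma> \<in> Sigma_L n (poset \<tau>)"
    and ab: "a \<in> diagram (sh \<tau>)" "b \<in> diagram (sh \<tau>)"
    and suc: "\<gamma> (entry \<tau> b) = \<gamma> (entry \<tau> a) + 1"
  shows "entry \<tau> b < entry \<tau> a \<longleftrightarrow> snd a < snd b \<and> fst b \<le> fst a"
proof
  assume "snd a < snd b \<and> fst b \<le> fst a"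
  then show "entry \<tau> b < entry \<tau> a" using distinguished_less[OF d ab(2,1)] by auto
next
  have t: "bijective_tableau n \<tau>" using d by (simp add: distinguished_def)
  note less = Sigma_L_less[OF t g]
  assume lt: "entry \<tau> b < entry \<tau> a"
  have "\<not> (fst a \<le> fst b \<and> snd b \<le> snd a)"
    using distinguished_less[OF d ab] lt by (metis less_asym less_irrefl)
  moreover have "\<not> SE b a" using less[OF ab(2,1)] suc by force
  moreover have "\<not> (fst a < fst b \<and> snd a < snd b)"
  proof
    assume h: "fst a < fst b \<and> snd a < snd b"
    let ?c = "(fst a, snd b)"
    have c: "?c \<in> diagram (sh \<tau>)" using order_convexD[OF bijective_tableauD(2)[OF t] ab] h by simp
    have "\<gamma> (entry \<tau> a) < \<gamma> (entry \<tau> ?c)" using less[OF ab(1) c] h by (auto simp: SE_def prod_eq_iff)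
    moreover have "\<gamma> (entry \<tau> ?c) < \<gamma> (entry \<tau> b)" using less[OF c ab(2)] h by (auto simp: SE_def prod_eq_iff)
    ultimately show False using suc by simp
  qed
  ultimately show "snd a < snd b \<and> fst b \<le> fst a" by (auto simp: SE_def)
qed

lemma mem_Des_L_iff:
  assumes t: "bijective_tableau n \<tau>" and g: "\<gamma> \<in> Sym n"
  shows "i \<in> Des_L n \<gamma> \<longleftrightarrow> (\<exists>a\<in>diagram (sh \<tau>). \<exists>b\<in>diagram (sh \<tau>).
    \<gamma> (entry \<tau> a) = i \<and> \<gamma> (entry \<tau> b) = i + 1 \<and> entry \<tau> b < entry \<tau> a)" (is "?L = ?R")
proof
  assume ?L
  then have i: "i \<in> {1..<n}" "inv \<gamma> (i + 1) < inv \<gamma> i" using Des_L_iff[OF g] by blast+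
  then have "inv \<gamma> i \<in> {1..n}" "inv \<gamma> (i + 1) \<in> {1..n}" 
    by (simp_all only: Sym_mem[OF Sym_inv[OF g]]) auto
  then obtain a b where ab: "a \<in> diagram (sh \<tau>)" "b \<in> diagram (sh \<tau>)"
    and e: "entry \<tau> a = inv \<gamma> i" "entry \<tau> b = inv \<gamma> (i + 1)"
    using bijective_tableauD(6)[OF t, of "inv \<gamma> i"] bijective_tableauD(6)[OF t, of "inv \<gamma> (i + 1)"] by blast
  have "\<gamma> (entry \<tau> a) = i" "\<gamma> (entry \<tau> b) = i + 1" "entry \<tau> b < entry \<tau> a"
    unfolding e using i(2) Sym_apply_inv[OF g] by simp_all
  then show ?R using ab by blast
next
  assume ?R
  then obtain a b where ab: "a \<in> diagram (sh \<tau>)" "b \<in> diagram (sh \<tau>)"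
    and h: "\<gamma> (entry \<tau> a) = i" "\<gamma> (entry \<tau> b) = i + 1" "entry \<tau> b < entry \<tau> a" by blast
  have "i \<in> {1..n}" "i + 1 \<in> {1..n}"
    using Sym_mem[OF g, of "entry \<tau> a"] Sym_mem[OF g, of "entry \<tau> b"]
      bijective_tableauD(4)[OF t ab(1)] bijective_tableauD(4)[OF t ab(2)] unfolding h(1,2) by blast+
  moreover have "inv \<gamma> i = entry \<tau> a" "inv \<gamma> (i + 1) = entry \<tau> b"
    using Sym_inv_apply[OF g, of "entry \<tau> a"] Sym_inv_apply[OF g, of "entry \<tau> b"] by (simp_all only: h(1,2))
  ultimately show ?L using h(3) Des_L_iff[OF g] by auto
qed

section \<open>Labelings of the same shape\<close>

text \<open>The bijection sends a permutation to the one with the same filling of the common diagram, which is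
  multiplication on the right by the permutation \<open>g\<close> relating the two labelings.\<close>
lemma same_shape_descent_equiv:
  assumes d: "distinguished n \<tau>" and d': "distinguished n \<tau>'" and shp: "sh \<tau>' = sh \<tau>"
  shows "(Sigma_L n (poset \<tau>), Sigma_L n (poset \<tau>')) \<in> descent_equiv n"
proof -
  let ?D = "diagram (sh \<tau>)" and ?S = "Sigma_L n (poset \<tau>)" and ?S' = "Sigma_L n (poset \<tau>')"
  have t: "bijective_tableau n \<tau>" and t': "bijective_tableau n \<tau>'" using d d' by (auto simp: distinguished_def)
  have b: "bij_betw (entry \<tau>) ?D {1..n}" and b': "bij_betw (entry \<tau>') ?D {1..n}"
    using t t' shp by (auto simp: bijective_tableau_def)
  obtain g where g: "g \<in> Sym n" "\<forall>x\<in>{1..n}. g x = entry \<tau> (inv_into ?D (entry \<tau>') x)"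
    using exists_Sym_of_bij_betw[OF bij_betw_trans[OF bij_betw_inv_into[OF b'] b]] by auto
  have g_e: "g (entry \<tau>' a) = entry \<tau> a" if "a \<in> ?D" for a
    using g(2) bijective_tableauD(4)[OF t'] that shp bij_betw_inv_into_left[OF b' that] by simp
  have g_inv: "inv g (entry \<tau> a) = entry \<tau>' a" if "a \<in> ?D" for a
    using g_e[OF that] Sym_inv_apply[OF g(1)] by metis
  have fwd: "\<gamma> \<circ> g \<in> ?S'" if "\<gamma> \<in> ?S" for \<gamma>
    using that Sym_comp[OF _ g(1)] unfolding Sigma_L_iff[OF t] Sigma_L_iff[OF t'] shp by (simp add: g_e)
  have bwd: "\<delta> \<circ> inv g \<in> ?S" if "\<delta> \<in> ?S'" for \<delta>
    using that Sym_comp[OF _ Sym_inv[OF g(1)]] unfolding Sigma_L_iff[OF t] Sigma_L_iff[OF t'] shp by (simp add: g_inv)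
  have "bij_betw (\<lambda>\<gamma>. \<gamma> \<circ> g) ?S ?S'"
    by (rule bij_betw_byWitness[where f' = "\<lambda>\<delta>. \<delta> \<circ> inv g"]) (use fwd bwd g(1) in \<open>auto simp: fun_eq_iff\<close>)
  moreover have "(\<gamma>, \<delta>) \<in> weak_order n \<longleftrightarrow> (\<gamma> \<circ> g, \<delta> \<circ> g) \<in> weak_order n" if "\<gamma> \<in> ?S" "\<delta> \<in> ?S" for \<gamma> \<delta>
    unfolding Sigma_L_weak_order_iff[OF d that] Sigma_L_weak_order_iff[OF d' fwd[OF that(1)] fwd[OF that(2)]] shp
    by (simp add: g_e)
  moreover have "Des_L n \<gamma> = Des_L n (\<gamma> \<circ> g)" if S: "\<gamma> \<in> ?S" for \<gamma>
  proof (rule set_eqI)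
    fix i
    have sym: "\<gamma> \<in> Sym n" "\<gamma> \<circ> g \<in> Sym n" using S Sym_comp[OF _ g(1)] unfolding Sigma_L_iff[OF t] by blast+
    have "entry \<tau> b < entry \<tau> a \<longleftrightarrow> entry \<tau>' b < entry \<tau>' a"
      if "a \<in> ?D" "b \<in> ?D" "\<gamma> (entry \<tau> a) = i" "\<gamma> (entry \<tau> b) = i + 1" for a b
      using Sigma_L_descent_iff[OF d S, of a b] Sigma_L_descent_iff[OF d' fwd[OF S], of a b] that shp
      by (simp add: g_e)
    then show "i \<in> Des_L n \<gamma> \<longleftrightarrow> i \<in> Des_L n (\<gamma> \<circ> g)"
      unfolding mem_Des_L_iff[OF t sym(1)] mem_Des_L_iff[OF t' sym(2)] shp comp_apply
      using g_e by (metis (no_types, lifting))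
  qed
  ultimately show ?thesis
    unfolding descent_equiv_def using Sigma_L_is_interval[OF d] Sigma_L_is_interval[OF d'] by blast
qed

section \<open>Descent-preserving isomorphisms\<close>

text \<open>Exchanging the values \<open>j\<close> and \<open>j + 1\<close> upwards moves \<open>j\<close> to a later and \<open>j + 1\<close> to an earlier position,
  which can only destroy descents at \<open>j - 1\<close> and \<open>j + 1\<close>. So descent sets see by which simple
  transposition a cover was obtained.\<close>
lemma new_descent_unique:
  assumes b: "\<beta> \<in> Sym n" and j: "j \<in> {1..<n}" "inv \<beta> j < inv \<beta> (j + 1)"
    and i: "i \<in> Des_L n (simple_transp j \<circ> \<beta>)" "i \<notin> Des_L n \<beta>"
  shows "i = j"
proof (rule ccontr)
  assume ne: "i \<noteq> j"
  have "i \<in> {1..<n}" and 1: "inv \<beta> (simple_transp j (i + 1)) < inv \<beta> (simple_transp j i)"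
    using i(1) unfolding Des_L_iff[OF simple_transp_comp_Sym[OF b j(1)]] inv_simple_transp_comp[OF b j(1)] by blast+
  then have 2: "inv \<beta> i \<le> inv \<beta> (i + 1)" using i(2) Des_L_iff[OF b] by simp
  consider "i = j + 1" | "j = i + 1" | "i \<noteq> j + 1" "j \<noteq> i + 1" by blast
  then show False
    using 1 2 j ne by cases (simp_all add: simple_transp_def transpose_def)
qed

text \<open>Covers inside an interval are covers of the weak order, and \<open>f\<close> maps them to covers. Comparing
  descent sets, a cover by \<open>simple_transp i\<close> is mapped to a cover by the same \<open>simple_transp i\<close>;
  by induction along a chain from the bottom, \<open>f\<close> is determined by its value there.\<close>
lemma descent_iso_right_mult:
  assumes f: "bij_betw f (weak_interval n \<sigma>0 \<sigma>1) J" and J: "J = weak_interval n \<rho>0 \<rho>1"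
    and ord: "\<And>\<gamma> \<delta>. \<gamma> \<in> weak_interval n \<sigma>0 \<sigma>1 \<Longrightarrow> \<delta> \<in> weak_interval n \<sigma>0 \<sigma>1 \<Longrightarrow>
      (\<gamma>, \<delta>) \<in> weak_order n \<longleftrightarrow> (f \<gamma>, f \<delta>) \<in> weak_order n"
    and des: "\<And>\<gamma>. \<gamma> \<in> weak_interval n \<sigma>0 \<sigma>1 \<Longrightarrow> Des_L n \<gamma> = Des_L n (f \<gamma>)"
    and ne: "weak_interval n \<sigma>0 \<sigma>1 \<noteq> {}"
  shows "\<exists>\<pi>\<in>Sym n. \<forall>\<gamma>\<in>weak_interval n \<sigma>0 \<sigma>1. f \<gamma> = \<gamma> \<circ> \<pi>"
proof -
  let ?I = "weak_interval n \<sigma>0 \<sigma>1"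
  have I_iff: "\<gamma> \<in> ?I \<longleftrightarrow> \<sigma>0 \<in> Sym n \<and> \<sigma>1 \<in> Sym n \<and> \<gamma> \<in> Sym n \<and> Inv n \<sigma>0 \<subseteq> Inv n \<gamma> \<and> Inv n \<gamma> \<subseteq> Inv n \<sigma>1" for \<gamma>
    by (auto simp: weak_interval_def weak_order_iff)
  have J_iff: "\<gamma> \<in> J \<longleftrightarrow> \<rho>0 \<in> Sym n \<and> \<rho>1 \<in> Sym n \<and> \<gamma> \<in> Sym n \<and> Inv n \<rho>0 \<subseteq> Inv n \<gamma> \<and> Inv n \<gamma> \<subseteq> Inv n \<rho>1" for \<gamma>
    by (auto simp: J weak_interval_def weak_order_iff)
  have fJ: "f \<gamma> \<in> J" if "\<gamma> \<in> ?I" for \<gamma> using f that by (rule bij_betw_apply)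
  have s0: "\<sigma>0 \<in> Sym n" "\<sigma>0 \<in> ?I" using ne unfolding ex_in_conv[symmetric] I_iff by blast+
  define \<pi> where "\<pi> = inv \<sigma>0 \<circ> f \<sigma>0"
  have "f \<sigma>0 \<in> Sym n" using fJ[OF s0(2)] J_iff by blast
  then have "\<pi> \<in> Sym n" unfolding \<pi>_def using Sym_comp[OF Sym_inv[OF s0(1)]] by blast
  moreover have "f \<gamma> = \<gamma> \<circ> \<pi>" if g: "\<gamma> \<in> ?I" for \<gamma>
  proof -
    have "(\<sigma>0, \<gamma>) \<in> (weak_cover n)\<^sup>*" using g by (simp add: weak_interval_def weak_order_def)
    then show ?thesis using g
    proof (induction rule: rtrancl_induct)
      case base
      show ?case using s0(1) by (auto simp: \<pi>_def fun_eq_iff)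
    next
      case (step \<gamma> \<delta>)
      obtain i where i: "i \<in> {1..<n}" "inv \<gamma> i < inv \<gamma> (i + 1)" "\<delta> = simple_transp i \<circ> \<gamma>" and gS: "\<gamma> \<in> Sym n"
        using step(2) unfolding weak_cover_iff by blast
      have dS: "\<delta> \<in> Sym n" using simple_transp_comp_Sym[OF gS i(1)] i(3) by simp
      have Inv_d: "Inv n \<delta> = insert (inv \<gamma> i, inv \<gamma> (i + 1)) (Inv n \<gamma>)"
        using Inv_simple_transp_ascent[OF gS i(1,2)] i(3) by simp
      have "(\<sigma>0, \<gamma>) \<in> weak_order n" using step(1) s0(1) gS by (simp add: weak_order_def)
      then have gI: "\<gamma> \<in> ?I" using step.prems Inv_d gS unfolding I_iff weak_order_iff by blast
      have ne: "\<gamma> \<noteq> \<delta>"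
        using card_Inv_simple_transp_ascent[OF gS i(1,2)] i(3) by (metis less_add_one less_irrefl)
      let ?b = "f \<gamma>"
      have bS: "?b \<in> Sym n" "f \<delta> \<in> Sym n" using fJ[OF gI] fJ[OF step.prems] unfolding J_iff by blast+
      have "?b \<noteq> f \<delta>" using ne f gI step.prems by (meson bij_betw_def inj_onD)
      moreover have "Inv n ?b \<subseteq> Inv n (f \<delta>)"
        using ord[OF gI step.prems] Inv_d gS dS unfolding weak_order_iff by blast
      ultimately obtain j where j: "j \<in> {1..<n}" "inv ?b j < inv ?b (j + 1)"
        and sub: "Inv n (simple_transp j \<circ> ?b) \<subseteq> Inv n (f \<delta>)"
        using exists_step_towards[OF bS] by blast
      let ?h = "simple_transp j \<circ> ?b"
      have hS: "?h \<in> Sym n" using simple_transp_comp_Sym[OF bS(1) j(1)] .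
      have b_h: "Inv n ?b \<subseteq> Inv n ?h" using Inv_simple_transp_ascent[OF bS(1) j] by blast
      \<comment> \<open>the preimage of \<open>?h\<close> lies between \<open>\<gamma>\<close> and its cover \<open>\<delta>\<close>, which leaves only \<open>\<delta>\<close>\<close>
      have "?h \<in> J" using fJ[OF gI] fJ[OF step.prems] hS b_h sub unfolding J_iff by blast
      then obtain z where z: "z \<in> ?I" "f z = ?h" using f by (metis bij_betw_imp_surj_on imageE)
      have "Inv n \<gamma> \<subseteq> Inv n z" "Inv n z \<subseteq> Inv n \<delta>"
        using ord[OF gI z(1)] ord[OF z(1) step.prems] b_h sub bS hS z(2) unfolding weak_order_iff by auto
      then have "Inv n z = Inv n \<gamma> \<or> Inv n z = Inv n \<delta>" using Inv_d by auto
      moreover have zS: "z \<in> Sym n" using z(1) unfolding I_iff by blast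
      ultimately have "z = \<gamma> \<or> z = \<delta>" using Inv_inj[OF zS gS] Inv_inj[OF zS dS] by blast
      moreover have "?h \<noteq> ?b"
        using card_Inv_simple_transp_ascent[OF bS(1) j] by (metis less_add_one less_irrefl)
      ultimately have fd: "f \<delta> = ?h" using z(2) by auto
      have "i \<in> Des_L n \<delta>"
        unfolding i(3) Des_L_iff[OF simple_transp_comp_Sym[OF gS i(1)]] inv_simple_transp_comp[OF gS i(1)]
        using i(1,2) by (simp add: simple_transp_def)
      moreover have "i \<notin> Des_L n \<gamma>" using i(2) Des_L_iff[OF gS] by simp
      ultimately have "i = j"
        using new_descent_unique[OF bS(1) j] des[OF gI] des[OF step.prems] fd by simp
      then have "f \<delta> = simple_transp i \<circ> (\<gamma> \<circ> \<pi>)" using fd step.IH[OF gI] by (simp only:)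
      then show ?case by (simp only: i(3) o_assoc)
    qed
  qed
  ultimately show ?thesis by blast
qed

section \<open>Relabelings that preserve descents\<close>

text \<open>The assumptions hold for incomparable boxes and for covers of the poset.\<close>
lemma exists_consecutive_extension:
  assumes t: "bijective_tableau n \<tau>" and ab: "a \<in> diagram (sh \<tau>)" "b \<in> diagram (sh \<tau>)"
    and ba: "\<not> SE b a" and cov: "\<And>c. c \<in> diagram (sh \<tau>) \<Longrightarrow> SE a c \<Longrightarrow> SE c b \<Longrightarrow> c = a \<or> c = b"
  shows "\<exists>\<gamma>\<in>Sigma_L n (poset \<tau>). \<gamma> (entry \<tau> b) = \<gamma> (entry \<tau> a) + 1"
proof -
  let ?D = "diagram (sh \<tau>)" and ?e = "entry \<tau>"
  obtain \<sigma> where \<sigma>: "\<sigma> \<in> Sym n" "\<And>a b. a \<in> ?D \<Longrightarrow> b \<in> ?D \<Longrightarrow>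
    \<sigma> (?e a) < \<sigma> (?e b) \<longleftrightarrow> fst a < fst b \<or> fst a = fst b \<and> snd a < snd b"
    using exists_row_reading[OF t] by blast
  define h where "h c = \<sigma> (?e c)" for c
  have h_le: "h c \<le> n" if "c \<in> ?D" for c
    using Sym_mem[OF \<sigma>(1), of "?e c"] bijective_tableauD(4)[OF t that] by (simp add: h_def)
  have h_eq: "h c = h c' \<longleftrightarrow> c = c'" if "c \<in> ?D" "c' \<in> ?D" for c c'
    using bijective_tableauD(5)[OF t that] \<sigma>(1) by (simp add: h_def)
  have h_less: "h c < h c'" if "c \<in> ?D" "c' \<in> ?D" "SE c c'" "c \<noteq> c'" for c c'
    using \<sigma>(2)[OF that(1,2)] that(3,4) by (auto simp: h_def SE_def prod_eq_iff)
  have SE_trans: "SE c d \<Longrightarrow> SE d c' \<Longrightarrow> SE c c'" for c d c' by (auto simp: SE_def)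
  have SE_antisym: "SE c d \<Longrightarrow> SE d c \<Longrightarrow> c = d" for c d by (auto simp: SE_def prod_eq_iff)
  \<comment> \<open>list the boxes below \<open>a\<close> or \<open>b\<close> first, then \<open>a\<close>, then \<open>b\<close>, then all others\<close>
  define k where "k c = (if c = a then n + 1 else if c = b then n + 2
    else if SE c a \<or> SE c b then h c else n + 3 + h c)" for c
  have aneb: "a \<noteq> b" using ba by (auto simp: SE_def)
  have k_inj: "inj_on k ?D"
  proof (rule inj_onI)
    fix c c' assume c: "c \<in> ?D" "c' \<in> ?D" "k c = k c'"
    then show "c = c'"
      using h_le[OF c(1)] h_le[OF c(2)] h_eq[OF c(1,2)] by (simp add: k_def split: if_splits)
  qed
  have k_mono: "k c < k c'" if c: "c \<in> ?D" "c' \<in> ?D" "SE c c'" "c \<noteq> c'" for c c'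
  proof -
    consider "c' = a" | "c' = b" | "c' \<noteq> a" "c' \<noteq> b" "SE c' a \<or> SE c' b"
      | "c' \<noteq> a" "c' \<noteq> b" "\<not> SE c' a" "\<not> SE c' b" by blast
    then show ?thesis
    proof cases
      case 1
      then show ?thesis using c ba h_le[OF c(1)] by (auto simp: k_def)
    next
      case 2
      then show ?thesis using c aneb h_le[OF c(1)] by (auto simp: k_def)
    next
      case 3
      have "c \<noteq> a" using 3 c cov[OF c(2)] SE_antisym by blast
      moreover have "c \<noteq> b" using 3 c ba SE_trans SE_antisym by blast
      moreover have "SE c a \<or> SE c b" using 3 c SE_trans by blast
      ultimately show ?thesis using 3 h_less[OF c] by (simp add: k_def)
    next
      case 4
      then show ?thesis using h_less[OF c] h_le[OF c(1)] by (simp add: k_def)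
    qed
  qed
  obtain \<gamma> where \<gamma>: "\<gamma> \<in> Sym n" "\<And>c d. c \<in> ?D \<Longrightarrow> d \<in> ?D \<Longrightarrow> \<gamma> (?e c) < \<gamma> (?e d) \<longleftrightarrow> k c < k d"
    using exists_Sym_of_key[OF t k_inj] by blast
  have "\<gamma> (?e c) \<le> \<gamma> (?e d)" if "c \<in> ?D" "d \<in> ?D" "SE c d" for c d
    using \<gamma>(2)[OF that(1,2)] k_mono[OF that] by (cases "c = d") auto
  then have "\<gamma> \<in> Sigma_L n (poset \<tau>)" using \<gamma>(1) unfolding Sigma_L_iff[OF t] by blast
  moreover have "\<gamma> (?e b) = \<gamma> (?e a) + 1"
  proof (rule ccontr)
    assume no: "\<not> ?thesis"
    have "\<gamma> (?e a) < \<gamma> (?e b)" using \<gamma>(2)[OF ab] aneb by (simp add: k_def)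
    then have lt: "\<gamma> (?e a) + 1 < \<gamma> (?e b)" using no by simp
    have "\<gamma> (?e b) \<in> {1..n}" using Sym_mem[OF \<gamma>(1)] bijective_tableauD(4)[OF t ab(2)] by blast
    then have "inv \<gamma> (\<gamma> (?e a) + 1) \<in> {1..n}" using lt Sym_mem[OF Sym_inv[OF \<gamma>(1)]] by simp
    then obtain c where c: "c \<in> ?D" "?e c = inv \<gamma> (\<gamma> (?e a) + 1)" using bijective_tableauD(6)[OF t] by blast
    then have "\<gamma> (?e c) = \<gamma> (?e a) + 1" using \<gamma>(1) by simp
    then have "k a < k c" "k c < k b" using \<gamma>(2)[OF ab(1) c(1)] \<gamma>(2)[OF c(1) ab(2)] lt by auto
    then show False using aneb by (simp add: k_def)
  qed
  ultimately show ?thesis by blast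
qed

text \<open>By preservation of descents, \<open>inv \<pi>\<close> keeps the order of the labels of every two boxes that receive
  consecutive values in some linear extension. These include all pairs in strict south-west position
  and all neighbours in a row or column, and such pairs generate the weak south-west order.\<close>
lemma distinguished_of_descent_preserving:
  assumes d: "distinguished n \<tau>" and p: "\<pi> \<in> Sym n"
    and des: "\<And>\<gamma>. \<gamma> \<in> Sigma_L n (poset \<tau>) \<Longrightarrow> Des_L n (\<gamma> \<circ> \<pi>) = Des_L n \<gamma>"
  shows "\<exists>\<tau>'. distinguished n \<tau>' \<and> sh \<tau>' = sh \<tau> \<and> Sigma_L n (poset \<tau>') = (\<lambda>\<gamma>. \<gamma> \<circ> \<pi>) ` Sigma_L n (poset \<tau>)"
proof -
  let ?D = "diagram (sh \<tau>)"
  have t: "bijective_tableau n \<tau>" using d by (simp add: distinguished_def)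
  note cv = bijective_tableauD(2)[OF t]
  define \<tau>' where "\<tau>' = (sh \<tau>, restrict (inv \<pi> \<circ> entry \<tau>) ?D)"
  have shp: "sh \<tau>' = sh \<tau>" by (simp add: \<tau>'_def sh_def)
  have ent: "entry \<tau>' a = inv \<pi> (entry \<tau> a)" if "a \<in> ?D" for a using that by (simp add: \<tau>'_def entry_def)
  have "bij_betw (inv \<pi> \<circ> entry \<tau>) ?D {1..n}"
    using t Sym_inv[OF p] permutes_imp_bij unfolding Sym_def bijective_tableau_def by (blast intro: bij_betw_trans)
  then have "bij_betw (entry \<tau>') ?D {1..n}" using ent by (simp cong: bij_betw_cong)
  then have t': "bijective_tableau n \<tau>'"
    using t shp by (simp add: bijective_tableau_def) (simp add: \<tau>'_def entry_def)
  \<comment> \<open>the descent at the value of \<open>a\<close> compares the labels of \<open>a\<close> and \<open>b\<close>\<close>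
  have pair: "entry \<tau>' b < entry \<tau>' a \<longleftrightarrow> entry \<tau> b < entry \<tau> a"
    if ab: "a \<in> ?D" "b \<in> ?D" "\<not> SE b a" and cov: "\<And>c. c \<in> ?D \<Longrightarrow> SE a c \<Longrightarrow> SE c b \<Longrightarrow> c = a \<or> c = b" for a b
  proof -
    obtain \<gamma> where g: "\<gamma> \<in> Sigma_L n (poset \<tau>)" and suc: "\<gamma> (entry \<tau> b) = \<gamma> (entry \<tau> a) + 1"
      using exists_consecutive_extension[OF t ab cov] by blast
    let ?i = "\<gamma> (entry \<tau> a)"
    have S: "\<gamma> \<in> Sym n" "\<gamma> \<circ> \<pi> \<in> Sym n" using g Sym_comp[OF _ p] unfolding Sigma_L_iff[OF t] by blast+
    have "?i \<in> {1..n}" "?i + 1 \<in> {1..n}"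
      using Sym_mem[OF S(1)] bijective_tableauD(4)[OF t] ab(1,2) suc by metis+
    then have i: "?i \<in> {1..<n}" by simp
    have "inv \<gamma> ?i = entry \<tau> a" "inv \<gamma> (?i + 1) = entry \<tau> b" using S(1) suc[symmetric] by simp_all
    then have 1: "?i \<in> Des_L n \<gamma> \<longleftrightarrow> entry \<tau> b < entry \<tau> a" using i Des_L_iff[OF S(1)] by simp
    have "(\<gamma> \<circ> \<pi>) (entry \<tau>' a) = ?i" "(\<gamma> \<circ> \<pi>) (entry \<tau>' b) = ?i + 1" using p ent ab suc by simp_all
    then have "inv (\<gamma> \<circ> \<pi>) ?i = entry \<tau>' a" "inv (\<gamma> \<circ> \<pi>) (?i + 1) = entry \<tau>' b"
      using Sym_inv_apply[OF S(2)] by metis+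
    then have "?i \<in> Des_L n (\<gamma> \<circ> \<pi>) \<longleftrightarrow> entry \<tau>' b < entry \<tau>' a" using i Des_L_iff[OF S(2)] by simp
    then show ?thesis using 1 des[OF g] by simp
  qed
  have less: "entry \<tau>' a < entry \<tau>' b"
    if "a \<in> ?D" "b \<in> ?D" "fst a \<le> fst b \<and> snd b \<le> snd a \<and> a \<noteq> b" for a b
    using that
  proof (induction "(fst b - fst a) + (snd a - snd b)" arbitrary: a rule: less_induct)
    case less
    note ab = less.prems(1,2)
    have lt: "entry \<tau> a < entry \<tau> b" using distinguished_less[OF d ab] less.prems(3) by blast
    consider (SW) "SW a b" | (row) "fst a = fst b" "snd b < snd a" | (col) "snd a = snd b" "fst a < fst b"
      using less.prems(3) by (fastforce simp: SW_def prod_eq_iff)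
    then show ?case
    proof cases
      case SW
      then have "\<not> SE a b" by (auto simp: SE_def SW_def)
      then show ?thesis
        using pair[OF ab(2,1)] lt SW by (auto simp: SE_def SW_def)
    next
      case row
      show ?thesis
      proof (cases "snd a = snd b + 1")
        case True
        have "c = b \<or> c = a" if "SE b c" "SE c a" for c
          using that row True by (auto simp: SE_def prod_eq_iff)
        moreover have "\<not> SE a b" using row by (auto simp: SE_def)
        ultimately show ?thesis using pair[OF ab(2,1)] lt by blast
      next
        case False
        let ?c = "(fst a, snd a - 1)"
        have c: "?c \<in> ?D" using order_convexD[OF cv ab(2,1)] row by simp
        have "c' = ?c \<or> c' = a" if "SE ?c c'" "SE c' a" for c'
          using that by (auto simp: SE_def prod_eq_iff)
        moreover have "\<not> SE a ?c" using row by (auto simp: SE_def)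
        moreover have "entry \<tau> a < entry \<tau> ?c" using distinguished_less[OF d ab(1) c] row by (simp add: prod_eq_iff)
        ultimately have "entry \<tau>' a < entry \<tau>' ?c" using pair[OF c ab(1)] by blast
        also have "\<dots> < entry \<tau>' b"
        proof (rule less.hyps[OF _ c ab(2)])
          show "fst b - fst ?c + (snd ?c - snd b) < fst b - fst a + (snd a - snd b)"
            using row by (simp add: diff_less_mono)
          show "fst ?c \<le> fst b \<and> snd b \<le> snd ?c \<and> ?c \<noteq> b" using row False by (auto simp: prod_eq_iff)
        qed
        finally show ?thesis .
      qed
    next
      case col
      show ?thesis
      proof (cases "fst b = fst a + 1")
        case True
        have "c = a \<or> c = b" if "SE a c" "SE c b" for c
          using that col True by (auto simp: SE_def prod_eq_iff)
        moreover have "\<not> SE b a" using col by (auto simp: SE_def)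
        ultimately have "\<not> entry \<tau>' b < entry \<tau>' a" using pair[OF ab] lt by (meson less_asym)
        moreover have "entry \<tau>' a \<noteq> entry \<tau>' b" using bijective_tableauD(5)[OF t'] ab shp less.prems(3) by simp
        ultimately show ?thesis by simp
      next
        case False
        let ?c = "(fst a + 1, snd a)"
        have c: "?c \<in> ?D" using order_convexD[OF cv ab] col by simp
        have "c' = a \<or> c' = ?c" if "SE a c'" "SE c' ?c" for c'
          using that by (auto simp: SE_def prod_eq_iff)
        moreover have "\<not> SE ?c a" by (auto simp: SE_def)
        moreover have "entry \<tau> a < entry \<tau> ?c" using distinguished_less[OF d ab(1) c] by (simp add: prod_eq_iff)
        ultimately have "\<not> entry \<tau>' ?c < entry \<tau>' a" using pair[OF ab(1) c] by (meson less_asym)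
        moreover have "entry \<tau>' a \<noteq> entry \<tau>' ?c"
          using bijective_tableauD(5)[OF t'] ab c shp by (simp add: prod_eq_iff)
        ultimately have "entry \<tau>' a < entry \<tau>' ?c" by simp
        also have "\<dots> < entry \<tau>' b"
        proof (rule less.hyps[OF _ c ab(2)])
          show "fst b - fst ?c + (snd ?c - snd b) < fst b - fst a + (snd a - snd b)"
            using col by (simp add: diff_less_mono2)
          show "fst ?c \<le> fst b \<and> snd b \<le> snd ?c \<and> ?c \<noteq> b" using col False by (auto simp: prod_eq_iff)
        qed
        finally show ?thesis .
      qed
    qed
  qed
  have d': "distinguished n \<tau>'" unfolding distinguished_def shp using t' less by blast
  have mem: "\<gamma> \<circ> \<pi> \<in> Sigma_L n (poset \<tau>') \<longleftrightarrow> \<gamma> \<in> Sigma_L n (poset \<tau>)" if "\<gamma> \<in> Sym n" for \<gamma>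
    unfolding Sigma_L_iff[OF t] Sigma_L_iff[OF t'] shp using that p Sym_comp[OF that p] by (simp add: ent)
  have "Sigma_L n (poset \<tau>') = (\<lambda>\<gamma>. \<gamma> \<circ> \<pi>) ` Sigma_L n (poset \<tau>)"
  proof (rule set_eqI)
    fix \<delta>
    show "\<delta> \<in> Sigma_L n (poset \<tau>') \<longleftrightarrow> \<delta> \<in> (\<lambda>\<gamma>. \<gamma> \<circ> \<pi>) ` Sigma_L n (poset \<tau>)"
    proof
      assume \<delta>: "\<delta> \<in> Sigma_L n (poset \<tau>')"
      then have "\<delta> \<in> Sym n" unfolding Sigma_L_iff[OF t'] by blast
      then have "\<delta> \<circ> inv \<pi> \<in> Sym n" using Sym_comp Sym_inv[OF p] by blast
      moreover have eq: "\<delta> = (\<delta> \<circ> inv \<pi>) \<circ> \<pi>" using p by (simp add: fun_eq_iff)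
      ultimately have "\<delta> \<circ> inv \<pi> \<in> Sigma_L n (poset \<tau>)" using mem \<delta> by metis
      then show "\<delta> \<in> (\<lambda>\<gamma>. \<gamma> \<circ> \<pi>) ` Sigma_L n (poset \<tau>)" using eq by blast
    next
      assume "\<delta> \<in> (\<lambda>\<gamma>. \<gamma> \<circ> \<pi>) ` Sigma_L n (poset \<tau>)"
      then obtain \<gamma> where g: "\<gamma> \<in> Sigma_L n (poset \<tau>)" "\<delta> = \<gamma> \<circ> \<pi>" by blast
      then have "\<gamma> \<in> Sym n" unfolding Sigma_L_iff[OF t] by blast
      then show "\<delta> \<in> Sigma_L n (poset \<tau>')" using mem g by blast
    qed
  qed
  then show ?thesis using d' shp by blast
qed

section \<open>The descent class of a regular Schur labeled skew shape poset\<close>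

theorem theorem4p7:
  fixes n :: nat and P :: "(nat \<times> nat) set"
  assumes "P \<in> RSP n"
  shows "descent_equiv n `` {Sigma_L n P} =
         {Sigma_L n Q | Q. Q \<in> RSP n \<and> sh (tau n Q) = sh (tau n P)}"
proof -
  obtain \<tau> where d: "distinguished n \<tau>" and P: "poset \<tau> = P" using assms unfolding RSP_iff by blast
  have tP: "tau n P = \<tau>" using tau_poset[OF d] P by simp
  show ?thesis
  proof (rule set_eqI)
    fix J
    show "J \<in> descent_equiv n `` {Sigma_L n P} \<longleftrightarrow>
      J \<in> {Sigma_L n Q | Q. Q \<in> RSP n \<and> sh (tau n Q) = sh (tau n P)}"
    proof
      assume "J \<in> descent_equiv n `` {Sigma_L n P}"
      then obtain f where J: "J \<in> Int_L n" and f: "bij_betw f (Sigma_L n P) J"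
        and ord: "\<forall>\<gamma>\<in>Sigma_L n P. \<forall>\<delta>\<in>Sigma_L n P. (\<gamma>, \<delta>) \<in> weak_order n \<longleftrightarrow> (f \<gamma>, f \<delta>) \<in> weak_order n"
        and des: "\<forall>\<gamma>\<in>Sigma_L n P. Des_L n \<gamma> = Des_L n (f \<gamma>)"
        unfolding descent_equiv_def by blast
      obtain \<sigma>0 \<sigma>1 where I: "Sigma_L n P = weak_interval n \<sigma>0 \<sigma>1" "weak_interval n \<sigma>0 \<sigma>1 \<noteq> {}"
        using Sigma_L_is_interval[OF d] unfolding P Int_L_def by blast
      obtain \<rho>0 \<rho>1 where J': "J = weak_interval n \<rho>0 \<rho>1" using J unfolding Int_L_def by blast
      obtain \<pi> where p: "\<pi> \<in> Sym n" "\<forall>\<gamma>\<in>Sigma_L n P. f \<gamma> = \<gamma> \<circ> \<pi>"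
        using descent_iso_right_mult[OF _ J', of f \<sigma>0 \<sigma>1] f ord des I by metis
      have "Des_L n (\<gamma> \<circ> \<pi>) = Des_L n \<gamma>" if "\<gamma> \<in> Sigma_L n (poset \<tau>)" for \<gamma>
        using that des p(2) P by simp
      from distinguished_of_descent_preserving[OF d p(1) this]
      obtain \<tau>' where d': "distinguished n \<tau>'" "sh \<tau>' = sh \<tau>"
        and S: "Sigma_L n (poset \<tau>') = (\<lambda>\<gamma>. \<gamma> \<circ> \<pi>) ` Sigma_L n P" using P by blast
      have "J = f ` Sigma_L n P" using f by (simp add: bij_betw_imp_surj_on)
      also have "\<dots> = Sigma_L n (poset \<tau>')" unfolding S using p(2) by (intro image_cong) auto
      finally have "J = Sigma_L n (poset \<tau>')" .
      moreover have "poset \<tau>' \<in> RSP n" using d'(1) RSP_iff by blast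
      moreover have "sh (tau n (poset \<tau>')) = sh (tau n P)" using tau_poset[OF d'(1)] tP d'(2) by simp
      ultimately show "J \<in> {Sigma_L n Q | Q. Q \<in> RSP n \<and> sh (tau n Q) = sh (tau n P)}" by blast
    next
      assume "J \<in> {Sigma_L n Q | Q. Q \<in> RSP n \<and> sh (tau n Q) = sh (tau n P)}"
      then obtain Q where Q: "Q \<in> RSP n" "sh (tau n Q) = sh (tau n P)" "J = Sigma_L n Q" by blast
      then obtain \<tau>' where d': "distinguished n \<tau>'" "poset \<tau>' = Q" unfolding RSP_iff by blast
      then have "sh \<tau>' = sh \<tau>" using Q(2) tau_poset[OF d'(1)] tP by simp
      then show "J \<in> descent_equiv n `` {Sigma_L n P}"
        using same_shape_descent_equiv[OF d d'(1)] d'(2) P Q(3) by blast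
    qed
  qed
qed

end
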